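(* Let $p\colon\mathbb{R}\to\mathbb{R}$ be bounded and uniformly continuous, assume that $x'=-x^2+p(t)$ has exactly two hyperbolic solutions, and take $c>0$. Suppose that the equation $$y'=-\Big(y-\frac{2}{\pi}\arctan(ct)\Big)^2+p(t)\qquad(E_c)$$ has two different hyperbolic solutions (Case A). Then, with $\mathfrak{a}_c,\mathfrak{r}_c,\tilde{\mathfrak{a}}^\pm,\tilde{\mathfrak{r}}^\pm$ as in the context: (A1) The hyperbolic solutions of $(E_c)$ are given by $\mathfrak{r}_c$ and $\mathfrak{a}_c$. (A2) If $y_0>\mathfrak{a}_c(s)$, then $y_c(t,s,y_0)$ is unbounded as $t$ decreases, and $\lim_{t\to\infty}|\mathfrak{a}_c(t)-y_c(t,s,y_0)|=0$. (A3) If $\mathfrak{r}_c(s)<y_0<\mathfrak{a}_c(s)$, then $y_c(t,s,y_0)$ is globally defined and bounded, and $\lim_{t\to\infty}|\mathfrak{a}_c(t)-y_c(t,s,y_0)|=\lim_{t\to-\infty}|\mathfrak{r}_c(t)-y_c(t,s,y_0)|=0$. (A4) If $y_0<\mathfrak{r}_c(s)$, then $y_c(t,s,y_0)$ is unbounded as $t$ increases, and $\lim_{t\to-\infty}|\mathfrak{r}_c(t)-y_c(t,s,y_0)|=0$. (A5) $\lim_{t\to\pm\infty}|\tilde{\mathfrak{a}}^\pm(t)-\mathfrak{a}_c(t)|=0$ and $\lim_{t\to\pm\infty}|\tilde{\mathfrak{r}}^\pm(t)-\mathfrak{r}_c(t)|=0$ (upper signs together, lower signs together).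
   Context: $t\mapsto y_c(t,s,y_0)$ is the maximal solution of $(E_c)$ with $y_c(s,s,y_0)=y_0$. "Unbounded as $t$ decreases (increases)" means unbounded on the part of its maximal interval to the left (right) of $s$. A globally defined solution $\tilde b$ of a scalar equation $x'=h(t,x)$ is hyperbolic if there are $k\ge1$, $\beta>0$ such that either $\exp\int_s^t\frac{\partial h}{\partial x}(l,\tilde b(l))\,dl\le k\,e^{-\beta(t-s)}$ whenever $t\ge s$ (attractive), or $\exp\int_s^t\frac{\partial h}{\partial x}(l,\tilde b(l))\,dl\le k\,e^{\beta(t-s)}$ whenever $t\le s$ (repulsive). The two hyperbolic solutions of $x'=-x^2+p(t)$ are denoted $\tilde a$ (attractive) and $\tilde r$ (repulsive); then $\inf_{t\in\mathbb R}(\tilde a(t)-\tilde r(t))>0$. Put $\tilde{\mathfrak{a}}^\pm:=\tilde a\pm1$ and $\tilde{\mathfrak{r}}^\pm:=\tilde r\pm1$; these are the hyperbolic solutions of the limit equations $y'=-(y\mp1)^2+p(t)$. $\mathcal{R}_c^-$ is the set of $s\in\mathbb{R}$ for which there is $y_0$ such that $y_c(\cdot,s,y_0)$ is bounded above on the part of its maximal interval to the left of $s$, and $\mathfrak{a}_c(s)$ is the maximum of these $y_0$. $\mathcal{R}_c^+$ is the set of $s$ for which there is $y_0$ such that $y_c(\cdot,s,y_0)$ is bounded below on the part of its maximal interval to the right of $s$, and $\mathfrak{r}_c(s)$ is the minimum of these $y_0$. Under the assumption on $p$, $\mathfrak{a}_c\colon\mathcal{R}_c^-\to\mathbb{R}$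 and $\mathfrak{r}_c\colon\mathcal{R}_c^+\to\mathbb{R}$ exist for every $c>0$ and are solutions of $(E_c)$; if $(E_c)$ has a bounded globally defined solution, then $\mathcal{R}_c^-=\mathcal{R}_c^+=\mathbb{R}$. *)

theory Defs
  imports "HOL-Analysis.Analysis"
begin

text \<open>A scalar equation \<open>x' = h(t, x)\<close> is represented by its right-hand side \<open>h\<close>.\<close>

definition solution_on :: "(real \<Rightarrow> real \<Rightarrow> real) \<Rightarrow> real set \<Rightarrow> (real \<Rightarrow> real) \<Rightarrow> bool" where
  "solution_on h I x \<longleftrightarrow>
     open I \<and> is_interval I \<and> (\<forall>t\<in>I. (x has_real_derivative h t (x t)) (at t))"

text \<open>The maximal solution through \<open>(s, y\<^sub>0)\<close> is obtained by gluing all solutions through that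
  point. The definite description is meaningful for \<open>t \<in> max_interval h s y0\<close>, as soon as initial
  value problems for \<open>h\<close> are uniquely solvable; outside this interval the value is arbitrary.\<close>

definition max_interval :: "(real \<Rightarrow> real \<Rightarrow> real) \<Rightarrow> real \<Rightarrow> real \<Rightarrow> real set" where
  "max_interval h s y0 = \<Union>{I. \<exists>x. solution_on h I x \<and> s \<in> I \<and> x s = y0}"

definition max_solution :: "(real \<Rightarrow> real \<Rightarrow> real) \<Rightarrow> real \<Rightarrow> real \<Rightarrow> real \<Rightarrow> real" where
  "max_solution h s y0 t =
     (THE v. \<exists>I x. solution_on h I x \<and> s \<in> I \<and> x s = y0 \<and> t \<in> I \<and> x t = v)"

definition left_part :: "(real \<Rightarrow> real \<Rightarrow> real) \<Rightarrow> real \<Rightarrow> real \<Rightarrow> real set" where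
  "left_part h s y0 = max_solution h s y0 ` (max_interval h s y0 \<inter> {..s})"

definition right_part :: "(real \<Rightarrow> real \<Rightarrow> real) \<Rightarrow> real \<Rightarrow> real \<Rightarrow> real set" where
  "right_part h s y0 = max_solution h s y0 ` (max_interval h s y0 \<inter> {s..})"

text \<open>The interval integral is oriented, so for \<open>t \<le> s\<close> it is minus the integral over \<open>[t, s]\<close>.\<close>

definition attractive_hyperbolic :: "(real \<Rightarrow> real \<Rightarrow> real) \<Rightarrow> (real \<Rightarrow> real) \<Rightarrow> bool" where
  "attractive_hyperbolic h b \<longleftrightarrow> solution_on h UNIV b \<and>
     (\<exists>k\<ge>1. \<exists>\<beta>>0. \<forall>s t. t \<ge> s \<longrightarrow>
        exp (LBINT l=ereal s..ereal t. deriv (h l) (b l)) \<le> k * exp (- \<beta> * (t - s)))"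

definition repulsive_hyperbolic :: "(real \<Rightarrow> real \<Rightarrow> real) \<Rightarrow> (real \<Rightarrow> real) \<Rightarrow> bool" where
  "repulsive_hyperbolic h b \<longleftrightarrow> solution_on h UNIV b \<and>
     (\<exists>k\<ge>1. \<exists>\<beta>>0. \<forall>s t. t \<le> s \<longrightarrow>
        exp (LBINT l=ereal s..ereal t. deriv (h l) (b l)) \<le> k * exp (\<beta> * (t - s)))"

definition hyperbolic :: "(real \<Rightarrow> real \<Rightarrow> real) \<Rightarrow> (real \<Rightarrow> real) \<Rightarrow> bool" where
  "hyperbolic h b \<longleftrightarrow> attractive_hyperbolic h b \<or> repulsive_hyperbolic h b"

definition riccati :: "(real \<Rightarrow> real) \<Rightarrow> real \<Rightarrow> real \<Rightarrow> real" where
  "riccati p t x = - (x\<^sup>2) + p t"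

definition transition_eq :: "(real \<Rightarrow> real) \<Rightarrow> real \<Rightarrow> real \<Rightarrow> real \<Rightarrow> real" where
  "transition_eq p c t y = - ((y - 2 / pi * arctan (c * t))\<^sup>2) + p t"

text \<open>When the Riccati equation has exactly two hyperbolic solutions, one of them is attractive and
  the other one repulsive, which makes the following two descriptions proper.\<close>

definition a_tilde :: "(real \<Rightarrow> real) \<Rightarrow> real \<Rightarrow> real" where
  "a_tilde p = (THE b. attractive_hyperbolic (riccati p) b)"

definition r_tilde :: "(real \<Rightarrow> real) \<Rightarrow> real \<Rightarrow> real" where
  "r_tilde p = (THE b. repulsive_hyperbolic (riccati p) b)"

definition a_plus :: "(real \<Rightarrow> real) \<Rightarrow> real \<Rightarrow> real" where
  "a_plus p t = a_tilde p t + 1"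

definition a_minus :: "(real \<Rightarrow> real) \<Rightarrow> real \<Rightarrow> real" where
  "a_minus p t = a_tilde p t - 1"

definition r_plus :: "(real \<Rightarrow> real) \<Rightarrow> real \<Rightarrow> real" where
  "r_plus p t = r_tilde p t + 1"

definition r_minus :: "(real \<Rightarrow> real) \<Rightarrow> real \<Rightarrow> real" where
  "r_minus p t = r_tilde p t - 1"

text \<open>\<open>upper_sol p c\<close> and \<open>lower_sol p c\<close> are the functions \<open>\<aa>\<^sub>c\<close> and \<open>\<rr>\<^sub>c\<close>; they are
  meaningful on their domains \<open>R_minus p c\<close> and \<open>R_plus p c\<close> only.\<close>

definition R_minus :: "(real \<Rightarrow> real) \<Rightarrow> real \<Rightarrow> real set" where
  "R_minus p c = {s. \<exists>y0. bdd_above (left_part (transition_eq p c) s y0)}"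

definition upper_sol :: "(real \<Rightarrow> real) \<Rightarrow> real \<Rightarrow> real \<Rightarrow> real" where
  "upper_sol p c s = (GREATEST y0. bdd_above (left_part (transition_eq p c) s y0))"

definition R_plus :: "(real \<Rightarrow> real) \<Rightarrow> real \<Rightarrow> real set" where
  "R_plus p c = {s. \<exists>y0. bdd_below (right_part (transition_eq p c) s y0)}"

definition lower_sol :: "(real \<Rightarrow> real) \<Rightarrow> real \<Rightarrow> real \<Rightarrow> real" where
  "lower_sol p c s = (LEAST y0. bdd_below (right_part (transition_eq p c) s y0))"

end

theory Submission
  imports Defs
begin

text \<open>Everything rests on the fact that a Riccati equation is solved by quadratures once one global
  solution is known. Both equations have the form \<open>y' = -(y - g(t))\<^sup>2 + p(t)\<close> with \<open>g\<close> and \<open>p\<close>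
  bounded. Let \<open>b\<close> be an attractive hyperbolic solution and take \<open>G' = 2 (b - g)\<close> and
  \<open>H' = exp (- G)\<close>. Substituting \<open>y = b + 1 / w\<close> makes the equation linear in \<open>w\<close>, so that the
  solutions other than \<open>b\<close> are \<open>b + exp (- G) / (C + H)\<close> with a real parameter \<open>C\<close>. Attractivity
  makes \<open>exp (- G)\<close> integrable at \<open>+\<infinity>\<close>, and \<open>H\<close> can be normalised to increase from \<open>-\<infinity>\<close> to \<open>0\<close>.
  The phase portrait is then read off from the sign of \<open>C + H\<close>: the member with \<open>C = 0\<close> is a
  solution \<open>r\<close> below \<open>b\<close>; those with \<open>C < 0\<close> lie between \<open>r\<close> and \<open>b\<close>; the ones
  above \<open>b\<close> have \<open>C > 0\<close> and blow up in the past where \<open>H = -C\<close>; and every solution above \<open>r\<close>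
  approaches \<open>b\<close> in the future, because \<open>exp (- G)\<close> decays while \<open>C + H\<close> stays away from \<open>0\<close>
  (\<open>forward_attraction\<close>, \<open>left_part_not_bdd_above\<close>). Moreover \<open>r\<close> is repulsive (\<open>repulsive_r\<close>).
  Hence \<open>b\<close> is characterised as the largest solution that is bounded above in the past, which
  gives uniqueness as well as the identification with \<open>\<aa>\<^sub>c\<close>.

  The map \<open>y(t) \<mapsto> - y(-t)\<close> preserves this class of equations and exchanges attractive with
  repulsive solutions and upper with lower ones. It turns each statement about \<open>b\<close> into one about
  a repulsive solution. In particular one hyperbolic solution of either kind produces the other kind,
  so that the hyperbolic solutions form exactly one attractive--repulsive pair.

  For the comparison with the limit equations, let \<open>a\<close> and \<open>a\<^sub>0\<close> be the attractive solutions for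
  the shift \<open>g\<close> and for the shift \<open>0\<close>. Then \<open>v = a - g - a\<^sub>0\<close> satisfies
  \<open>v' = -((a - g) + a\<^sub>0) v - g'\<close>. Its coefficient is the mean of \<open>2 (a - g)\<close> and \<open>2 a\<^sub>0\<close>, hence the
  linear part is exponentially stable (\<open>exp_stable_mean\<close>), and a bounded solution of such an
  equation tends to \<open>0\<close> wherever the forcing \<open>g'\<close> does (\<open>forced_linear_tendsto_0\<close>). For the
  arctangent, \<open>g'\<close> vanishes at both ends while \<open>g\<close> tends to \<open>\<plusminus>1\<close>.\<close>

section \<open>Scalar linear equations\<close>

text \<open>Applied to the difference of two solutions of a
  Riccati equation, it gives uniqueness and shows that solutions keep their order.\<close>

lemma linear_ode_scaling:
  fixes u q :: "real \<Rightarrow> real"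
  assumes "a \<le> b" and q: "continuous_on {a..b} q"
    and u: "\<And>t. t \<in> {a..b} \<Longrightarrow> (u has_real_derivative q t * u t) (at t)"
  obtains k where "k > 0" "u b = k * u a"
proof -
  from antiderivative_continuous[OF q] obtain Q where
    Q: "\<And>t. t \<in> {a..b} \<Longrightarrow> (Q has_vector_derivative q t) (at t within {a..b})"
    by blast
  have "\<exists>c. \<forall>t\<in>{a..b}. u t * exp (- Q t) = c"
  proof (rule has_field_derivative_zero_constant)
    fix t assume t: "t \<in> {a..b}"
    have "(Q has_real_derivative q t) (at t within {a..b})"
      using Q[OF t] by (simp add: has_real_derivative_iff_has_vector_derivative)
    moreover have "(u has_real_derivative q t * u t) (at t within {a..b})"
      using u[OF t] by (rule has_field_derivative_at_within)
    ultimately show "((\<lambda>t. u t * exp (- Q t)) has_real_derivative 0) (at t within {a..b})"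
      by (auto intro!: derivative_eq_intros)
  qed simp
  then have "u b * exp (- Q b) = u a * exp (- Q a)"
    using \<open>a \<le> b\<close> by force
  then have "u b = exp (Q b - Q a) * u a"
    by (simp add: exp_minus exp_diff field_simps)
  then show ?thesis
    using that[of "exp (Q b - Q a)"] by simp
qed

lemma antiderivative_on_UNIV:
  fixes f :: "real \<Rightarrow> real"
  assumes "continuous_on UNIV f"
  obtains F where "\<And>t. (F has_real_derivative f t) (at t)"
proof -
  have "\<exists>F. \<forall>x. (-\<infinity>::ereal) < x \<longrightarrow> x < (\<infinity>::ereal) \<longrightarrow> (F has_vector_derivative f x) (at x)"
    using assms by (intro einterval_antiderivative) (auto simp: continuous_on_eq_continuous_at)
  then show ?thesis
    using that by (auto simp: has_real_derivative_iff_has_vector_derivative)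
qed

text \<open>For \<open>F' = A\<close> this is exponential stability of \<open>v' = - A v\<close>, whose transition factor from \<open>s\<close> to
  \<open>t\<close> is \<open>exp (F s - F t)\<close>.\<close>

definition exp_stable :: "(real \<Rightarrow> real) \<Rightarrow> bool" where
  "exp_stable F \<longleftrightarrow> (\<exists>k\<ge>1. \<exists>\<beta>>0. \<forall>s t. s \<le> t \<longrightarrow> exp (F s - F t) \<le> k * exp (- \<beta> * (t - s)))"

text \<open>The transition factor of a mean is the geometric mean of the transition factors.\<close>

lemma exp_stable_mean:
  assumes "exp_stable F1" "exp_stable F2"
  shows "exp_stable (\<lambda>t. (F1 t + F2 t) / 2)"
proof -
  obtain k1 b1 where 1: "k1 \<ge> 1" "b1 > 0"
    "\<And>s t. s \<le> t \<Longrightarrow> exp (F1 s - F1 t) \<le> k1 * exp (- b1 * (t - s))"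
    using assms unfolding exp_stable_def by blast
  obtain k2 b2 where 2: "k2 \<ge> 1" "b2 > 0"
    "\<And>s t. s \<le> t \<Longrightarrow> exp (F2 s - F2 t) \<le> k2 * exp (- b2 * (t - s))"
    using assms unfolding exp_stable_def by blast
  have sq: "exp (x / 2) = sqrt (exp x)" for x :: real
    by (rule real_sqrt_unique[symmetric]) (simp_all flip: exp_double)
  show ?thesis
    unfolding exp_stable_def
  proof (intro exI conjI allI impI)
    show "1 \<le> sqrt (k1 * k2)" using 1 2 mult_mono[of 1 k1 1 k2] by simp
    show "0 < (b1 + b2) / 2" using 1 2 by simp
    fix s t :: real assume st: "s \<le> t"
    have "exp ((F1 s + F2 s) / 2 - (F1 t + F2 t) / 2) = sqrt (exp (F1 s - F1 t) * exp (F2 s - F2 t))"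
      by (simp add: sq[symmetric] flip: exp_add) (simp add: field_simps)
    also have "\<dots> \<le> sqrt ((k1 * exp (- b1 * (t - s))) * (k2 * exp (- b2 * (t - s))))"
      using 1(1) 2(1) by (intro real_sqrt_le_mono mult_mono 1(3) 2(3) st) auto
    also have "\<dots> = sqrt (k1 * k2) * sqrt (exp (- b1 * (t - s) + (- b2 * (t - s))))"
      by (simp only: real_sqrt_mult exp_add mult_ac)
    also have "\<dots> = sqrt (k1 * k2) * exp (- ((b1 + b2) / 2) * (t - s))"
      by (simp add: sq[symmetric]) (simp add: field_simps)
    finally show "exp ((F1 s + F2 s) / 2 - (F1 t + F2 t) / 2)
        \<le> sqrt (k1 * k2) * exp (- ((b1 + b2) / 2) * (t - s))" .
  qed
qed

text \<open>By variation of constants, \<open>v t\<close> is the sum of the transported initial value \<open>v s\<close>, at most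
  \<open>k V exp (- \<beta> (t - s))\<close> if \<open>V\<close> bounds \<open>v\<close>, and the response to \<open>e\<close> on \<open>{s..t}\<close>, at most
  \<open>\<eta> k / \<beta>\<close> if \<open>\<eta>\<close> bounds \<open>e\<close> there. At \<open>+\<infinity>\<close>
  the initial time \<open>s\<close> is fixed and \<open>t\<close> grows. At \<open>-\<infinity>\<close> it is the boundedness of \<open>v\<close> in the past
  that helps: \<open>t\<close> is fixed and \<open>s\<close> tends to \<open>-\<infinity>\<close>, which removes the initial value.\<close>

lemma forced_linear_tendsto_0:
  fixes v e A F :: "real \<Rightarrow> real"
  assumes F: "\<And>t. (F has_real_derivative A t) (at t)" and "exp_stable F"
    and v: "\<And>t. (v has_real_derivative - A t * v t + e t) (at t)"
    and bv: "bounded (range v)"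
  shows "(e \<longlongrightarrow> 0) at_top \<Longrightarrow> (v \<longlongrightarrow> 0) at_top"
    and "(e \<longlongrightarrow> 0) at_bot \<Longrightarrow> (v \<longlongrightarrow> 0) at_bot"
proof -
  obtain k \<beta> where k: "k \<ge> 1" and \<beta>: "\<beta> > 0"
    and st: "\<And>s t. s \<le> t \<Longrightarrow> exp (F s - F t) \<le> k * exp (- \<beta> * (t - s))"
    using \<open>exp_stable F\<close> unfolding exp_stable_def by blast
  obtain V where V: "V > 0" "\<And>t. \<bar>v t\<bar> \<le> V"
    using bv unfolding bounded_pos by auto
  have est: "\<bar>v t\<bar> \<le> k * V * exp (- \<beta> * (t - s)) + \<eta> * k / \<beta>"
    if "s \<le> t" and e: "\<And>x. x \<in> {s..t} \<Longrightarrow> \<bar>e x\<bar> \<le> \<eta>" for s t \<eta>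
  proof -
    \<comment> \<open>The derivative of \<open>B\<close> dominates that of \<open>v exp F\<close> on \<open>{s..t}\<close>; comparing the two functions
      replaces integrating the forcing term.\<close>
    define B where "B x = \<eta> * k / \<beta> * exp (F t) * exp (\<beta> * (x - t))" for x
    have "\<eta> \<ge> 0" using e[of s] \<open>s \<le> t\<close> by force
    have W: "((\<lambda>x. v x * exp (F x)) has_real_derivative e x * exp (F x)) (at x)" for x
      by (auto intro!: derivative_eq_intros v F) (simp add: algebra_simps)
    have B: "(B has_real_derivative \<eta> * (k * exp (F t) * exp (\<beta> * (x - t)))) (at x)" for x
      unfolding B_def using \<beta> by (auto intro!: derivative_eq_intros)
    have bnd: "\<bar>e x * exp (F x)\<bar> \<le> \<eta> * (k * exp (F t) * exp (\<beta> * (x - t)))"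
      if x: "x \<in> {s..t}" for x
    proof -
      have "exp (F x) = exp (F t) * exp (F x - F t)" by (simp flip: exp_add)
      also have "\<dots> \<le> exp (F t) * (k * exp (- \<beta> * (t - x)))"
        using st[of x t] x by simp
      finally have "exp (F x) \<le> k * exp (F t) * exp (\<beta> * (x - t))"
        by (simp add: algebra_simps)
      then show ?thesis
        using e[OF x] \<open>\<eta> \<ge> 0\<close> by (simp add: abs_mult mult_mono)
    qed
    have "B s - v s * exp (F s) \<le> B t - v t * exp (F t)"
    proof (rule DERIV_nonneg_imp_nondecreasing[OF \<open>s \<le> t\<close>], intro exI conjI)
      fix x assume "s \<le> x" "x \<le> t"
      then show "0 \<le> \<eta> * (k * exp (F t) * exp (\<beta> * (x - t))) - e x * exp (F x)"
        using bnd[of x] by (simp add: abs_le_iff)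
    qed (intro DERIV_diff B W)
    moreover have "B s + v s * exp (F s) \<le> B t + v t * exp (F t)"
    proof (rule DERIV_nonneg_imp_nondecreasing[OF \<open>s \<le> t\<close>], intro exI conjI)
      fix x assume "s \<le> x" "x \<le> t"
      then show "0 \<le> \<eta> * (k * exp (F t) * exp (\<beta> * (x - t))) + e x * exp (F x)"
        using bnd[of x] by (simp add: abs_le_iff)
    qed (intro DERIV_add B W)
    moreover have "B s \<ge> 0"
      unfolding B_def using \<open>\<eta> \<ge> 0\<close> k \<beta> by simp
    ultimately have "\<bar>v t * exp (F t)\<bar> \<le> \<bar>v s * exp (F s)\<bar> + B t"
      by linarith
    then have "\<bar>v t\<bar> * exp (F t) \<le> (\<bar>v s\<bar> * exp (F s - F t) + \<eta> * k / \<beta>) * exp (F t)"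
      by (simp add: abs_mult B_def algebra_simps flip: exp_add)
    then have "\<bar>v t\<bar> \<le> \<bar>v s\<bar> * exp (F s - F t) + \<eta> * k / \<beta>"
      by simp
    also have "\<bar>v s\<bar> * exp (F s - F t) \<le> V * (k * exp (- \<beta> * (t - s)))"
      using V(2)[of s] V(1) st[OF \<open>s \<le> t\<close>] by (intro mult_mono) auto
    finally show ?thesis by (simp add: mult_ac)
  qed
  have small: "\<exists>\<eta>>0. \<eta> * k / \<beta> < \<epsilon>" if "\<epsilon> > 0" for \<epsilon>
    using that k \<beta> by (intro exI[of _ "\<epsilon> * \<beta> / (2 * k)"]) (auto simp: field_simps)
  have decay: "((\<lambda>x. k * V * exp (- \<beta> * x) + c) \<longlongrightarrow> c) at_top" for c
  proof -
    have "((\<lambda>x. k * V * exp (- \<beta> * x) + c) \<longlongrightarrow> k * V * 0 + c) at_top"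
      using \<beta> by (intro tendsto_intros filterlim_compose[OF exp_at_bot]
          filterlim_tendsto_neg_mult_at_bot[OF tendsto_const] filterlim_ident) auto
    then show ?thesis by simp
  qed
  show "(v \<longlongrightarrow> 0) at_top" if e: "(e \<longlongrightarrow> 0) at_top"
  proof (rule tendstoI)
    fix \<epsilon> :: real assume "\<epsilon> > 0"
    then obtain \<eta> where \<eta>: "\<eta> > 0" "\<eta> * k / \<beta> < \<epsilon>" using small by blast
    from tendstoD[OF e \<open>\<eta> > 0\<close>] obtain T where T: "\<And>x. x \<ge> T \<Longrightarrow> \<bar>e x\<bar> \<le> \<eta>"
      by (force simp: eventually_at_top_linorder dist_real_def)
    have "filterlim (\<lambda>t. t - T) at_top at_top"
      using filterlim_tendsto_add_at_top[OF tendsto_const[of "- T"] filterlim_ident] by simp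
    from filterlim_compose[OF decay this]
    have "((\<lambda>t. k * V * exp (- \<beta> * (t - T)) + \<eta> * k / \<beta>) \<longlongrightarrow> \<eta> * k / \<beta>) at_top" .
    then have "eventually (\<lambda>t. k * V * exp (- \<beta> * (t - T)) + \<eta> * k / \<beta> < \<epsilon>) at_top"
      using \<eta> by (intro order_tendstoD) auto
    then show "eventually (\<lambda>t. dist (v t) 0 < \<epsilon>) at_top"
      using eventually_ge_at_top[of T]
    proof eventually_elim
      case (elim t)
      then show ?case using est[of T t \<eta>] T by fastforce
    qed
  qed
  show "(v \<longlongrightarrow> 0) at_bot" if e: "(e \<longlongrightarrow> 0) at_bot"
  proof (rule tendstoI)
    fix \<epsilon> :: real assume "\<epsilon> > 0"
    then obtain \<eta> where \<eta>: "\<eta> > 0" "\<eta> * k / \<beta> < \<epsilon>" using small by blast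
    from tendstoD[OF e \<open>\<eta> > 0\<close>] obtain T where T: "\<And>x. x \<le> T \<Longrightarrow> \<bar>e x\<bar> \<le> \<eta>"
      by (force simp: eventually_at_bot_linorder dist_real_def)
    have "\<bar>v t\<bar> \<le> \<eta> * k / \<beta>" if "t \<le> T" for t
    proof (rule tendsto_lowerbound)
      have "filterlim (\<lambda>s. t - s) at_top at_bot"
        using filterlim_tendsto_add_at_top[OF tendsto_const[of t] filterlim_uminus_at_top_at_bot] by simp
      from filterlim_compose[OF decay this]
      show "((\<lambda>s. k * V * exp (- \<beta> * (t - s)) + \<eta> * k / \<beta>) \<longlongrightarrow> \<eta> * k / \<beta>) at_bot" .
      show "eventually (\<lambda>s. \<bar>v t\<bar> \<le> k * V * exp (- \<beta> * (t - s)) + \<eta> * k / \<beta>) at_bot"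
        using eventually_le_at_bot[of t]
      proof eventually_elim
        case (elim s)
        then show ?case using est[of s t \<eta>] T \<open>t \<le> T\<close> by force
      qed
    qed simp
    then show "eventually (\<lambda>t. dist (v t) 0 < \<epsilon>) at_bot"
      using \<eta> unfolding eventually_at_bot_linorder by (intro exI[of _ T]) fastforce
  qed
qed

section \<open>Solutions of a shifted Riccati equation\<close>

text \<open>The common form of the two equations: the Riccati equation has shift \<open>g = 0\<close>, the transition
  equation has the scaled arctangent. Arbitrary \<open>g\<close> and \<open>p\<close> also make the class closed under time
  reversal.\<close>

definition shifted_riccati :: "(real \<Rightarrow> real) \<Rightarrow> (real \<Rightarrow> real) \<Rightarrow> real \<Rightarrow> real \<Rightarrow> real" where
  "shifted_riccati g p t y = - ((y - g t)\<^sup>2) + p t"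

lemma deriv_shifted_riccati: "deriv (shifted_riccati g p t) y = - (2 * (y - g t))"
  unfolding shifted_riccati_def
  by (rule DERIV_imp_deriv) (auto intro!: derivative_eq_intros)

lemma solution_continuous_on: "solution_on h I x \<Longrightarrow> continuous_on I x"
  unfolding solution_on_def by (meson DERIV_isCont continuous_at_imp_continuous_on)

lemma solution_on_Int:
  "solution_on h I x \<Longrightarrow> open J \<Longrightarrow> is_interval J \<Longrightarrow> solution_on h (I \<inter> J) x"
  unfolding solution_on_def using is_interval_Int open_Int by blast

lemma is_interval_atLeastAtMost_subset:
  fixes I :: "real set"
  assumes "is_interval I" "a \<in> I" "b \<in> I" shows "{a..b} \<subseteq> I"
  using mem_is_interval_1_I[OF assms] by auto

text \<open>The difference of two solutions solves \<open>u' = - (x + y - 2 g) u\<close>, a linear equation.\<close>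

lemma solution_difference_scaling:
  assumes g: "continuous_on UNIV g"
    and x: "solution_on (shifted_riccati g p) I x" and y: "solution_on (shifted_riccati g p) I y"
    and "s \<in> I" "t \<in> I"
  obtains k where "k > 0" "x t - y t = k * (x s - y s)"
proof -
  have forward: "\<exists>k>0. x b - y b = k * (x a - y a)" if "a \<in> I" "b \<in> I" "a \<le> b" for a b
  proof -
    have sub: "{a..b} \<subseteq> I"
      using that x by (intro is_interval_atLeastAtMost_subset) (auto simp: solution_on_def)
    have "((\<lambda>t. x t - y t) has_real_derivative - (x t + y t - 2 * g t) * (x t - y t)) (at t)"
      if "t \<in> {a..b}" for t
    proof -
      have "t \<in> I" using that sub by blast
      then have "((\<lambda>t. x t - y t) has_real_derivative
          shifted_riccati g p t (x t) - shifted_riccati g p t (y t)) (at t)"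
        using x y unfolding solution_on_def by (intro DERIV_diff) auto
      then show ?thesis
        by (simp add: shifted_riccati_def power2_eq_square algebra_simps)
    qed
    moreover have "continuous_on {a..b} (\<lambda>t. - (x t + y t - 2 * g t))"
      using sub by (intro continuous_intros continuous_on_subset[OF g]
          continuous_on_subset[OF solution_continuous_on[OF x]]
          continuous_on_subset[OF solution_continuous_on[OF y]]) auto
    ultimately show ?thesis
      using linear_ode_scaling[OF \<open>a \<le> b\<close>, of "\<lambda>t. - (x t + y t - 2 * g t)" "\<lambda>t. x t - y t"]
      by metis
  qed
  show ?thesis
  proof (cases "s \<le> t")
    case True
    then show ?thesis using forward[of s t] assms that by blast
  next
    case False
    then obtain k where "k > 0" "x s - y s = k * (x t - y t)"
      using forward[of t s] assms by auto
    then show ?thesis by (intro that[of "1 / k"]) (auto simp: field_simps)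
  qed
qed

lemma max_intervalI:
  "solution_on h I x \<Longrightarrow> s \<in> I \<Longrightarrow> t \<in> I \<Longrightarrow> t \<in> max_interval h s (x s)"
  unfolding max_interval_def by (rule UnionI[of I]) auto

lemma max_intervalE:
  assumes "t \<in> max_interval h s y0"
  obtains I x where "solution_on h I x" "s \<in> I" "t \<in> I" "x s = y0"
  using assms unfolding max_interval_def by (elim UnionE CollectE exE conjE) (rule that)

lemma max_solution_eq:
  assumes g: "continuous_on UNIV g"
    and x: "solution_on (shifted_riccati g p) I x" and "s \<in> I" "t \<in> I"
  shows "max_solution (shifted_riccati g p) s (x s) t = x t"
  unfolding max_solution_def
proof (rule the_equality)
  show "\<exists>J y. solution_on (shifted_riccati g p) J y \<and> s \<in> J \<and> y s = x s \<and> t \<in> J \<and> y t = x t"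
    using assms by blast
  fix v assume "\<exists>J y. solution_on (shifted_riccati g p) J y \<and> s \<in> J \<and> y s = x s \<and> t \<in> J \<and> y t = v"
  then obtain J y where y: "solution_on (shifted_riccati g p) J y" "s \<in> J" "y s = x s" "t \<in> J" "y t = v"
    by blast
  have "solution_on (shifted_riccati g p) (I \<inter> J) x" "solution_on (shifted_riccati g p) (I \<inter> J) y"
    using solution_on_Int[OF x, of J] solution_on_Int[OF y(1), of I] x y(1)
    by (auto simp: solution_on_def Int_commute)
  then obtain k where "x t - y t = k * (x s - y s)"
    using solution_difference_scaling[OF g, of p "I \<inter> J" x y s t] assms y by blast
  then show "v = x t" using y by simp
qed

text \<open>Hyperbolic solutions are defined globally, but boundedness is not part of their definition. It
  holds because a solution that gets too low escapes to \<open>-\<infinity>\<close> in finite time. The bound \<open>m\<close> is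
  chosen so that \<open>u = y - m\<close> satisfies \<open>u' \<le> - u (y + m) / 2\<close>. Once negative, \<open>u\<close> therefore
  remains negative, and \<open>1 / u\<close> grows at least with slope \<open>1/2\<close>, so it would reach \<open>0\<close>.\<close>

lemma bounded_below_of_global_solution:
  assumes g: "\<And>t. \<bar>g t\<bar> \<le> N" and p: "\<And>t. \<bar>p t\<bar> \<le> M"
    and y: "solution_on (shifted_riccati g p) UNIV y"
  shows "- sqrt (2 * (N\<^sup>2 + M)) \<le> y t\<^sub>0"
proof (rule ccontr)
  define m where "m = - sqrt (2 * (N\<^sup>2 + M))"
  have "M \<ge> 0" using p[of 0] by linarith
  then have m: "m \<le> 0" "m\<^sup>2 = 2 * (N\<^sup>2 + M)" by (simp_all add: m_def)
  define u where "u t = y t - m" for t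
  assume "\<not> - sqrt (2 * (N\<^sup>2 + M)) \<le> y t\<^sub>0"
  then have u0: "u t\<^sub>0 < 0" by (simp add: u_def m_def)
  define u' where "u' t = - ((y t - g t)\<^sup>2) + p t" for t
  have u': "(u has_real_derivative u' t) (at t)" for t
    unfolding u_def u'_def using y
    by (auto simp: solution_on_def shifted_riccati_def intro!: derivative_eq_intros)
  have u'_le: "u' t \<le> - (u t * ((y t + m) / 2))" for t
  proof -
    have "(y t)\<^sup>2 / 2 \<le> (y t - g t)\<^sup>2 + (g t)\<^sup>2"
      using zero_le_power2[of "y t - 2 * g t"] by (simp add: power2_eq_square algebra_simps)
    moreover have "(g t)\<^sup>2 \<le> N\<^sup>2"
      using g[of t] by (meson abs_le_square_iff abs_ge_self order_trans abs_le_iff)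
    moreover have "p t \<le> M" using p[of t] by linarith
    moreover have "u t * ((y t + m) / 2) = (y t)\<^sup>2 / 2 - m\<^sup>2 / 2"
      by (simp add: u_def power2_eq_square field_simps)
    moreover have "m\<^sup>2 / 2 = N\<^sup>2 + M" using m(2) by simp
    moreover define Y where "Y = (y t - g t)\<^sup>2"
    ultimately show ?thesis unfolding u'_def Y_def[symmetric] by linarith
  qed
  have "continuous_on UNIV (\<lambda>t. (y t + m) / 2)"
    using solution_continuous_on[OF y] by (auto intro!: continuous_intros)
  from antiderivative_on_UNIV[OF this] obtain Q where
    Q: "\<And>t. (Q has_real_derivative (y t + m) / 2) (at t)" by blast
  have neg: "u t < 0" if "t\<^sub>0 \<le> t" for t
  proof -
    have "u t * exp (Q t) \<le> u t\<^sub>0 * exp (Q t\<^sub>0)"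
    proof (rule DERIV_nonpos_imp_nonincreasing[OF that], intro exI conjI)
      fix x
      show "((\<lambda>t. u t * exp (Q t)) has_real_derivative (u' x + u x * ((y x + m) / 2)) * exp (Q x)) (at x)"
        by (auto intro!: derivative_eq_intros u' Q simp: algebra_simps)
      show "(u' x + u x * ((y x + m) / 2)) * exp (Q x) \<le> 0"
        using u'_le[of x] by (simp add: mult_le_0_iff)
    qed
    also have "\<dots> < 0" using u0 by (simp add: mult_less_0_iff)
    finally show ?thesis by (simp add: mult_less_0_iff)
  qed
  \<comment> \<open>The time at which the lower bound \<open>1 / u t\<^sub>0 + (t - t\<^sub>0) / 2\<close> for \<open>1 / u\<close> vanishes.\<close>
  define T where "T = t\<^sub>0 - 2 / u t\<^sub>0"
  have "t\<^sub>0 \<le> T" using u0 by (simp add: T_def divide_nonneg_neg)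
  then have "1 / u t\<^sub>0 - t\<^sub>0 / 2 \<le> 1 / u T - T / 2"
  proof (rule DERIV_nonneg_imp_nondecreasing, intro exI conjI)
    fix x assume x: "t\<^sub>0 \<le> x" "x \<le> T"
    show "((\<lambda>t. 1 / u t - t / 2) has_real_derivative - u' x / (u x)\<^sup>2 - 1 / 2) (at x)"
      using neg[OF x(1)] by (auto intro!: derivative_eq_intros u' simp: power2_eq_square)
    have "1 / 2 \<le> (y x + m) / (2 * u x)"
      using neg[OF x(1)] m(1) by (simp add: u_def field_simps)
    also have "\<dots> = u x * ((y x + m) / 2) / (u x)\<^sup>2"
      using neg[OF x(1)] by (simp add: power2_eq_square)
    also have "\<dots> \<le> - u' x / (u x)\<^sup>2"
      using u'_le[of x] by (intro divide_right_mono) auto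
    finally show "0 \<le> - u' x / (u x)\<^sup>2 - 1 / 2" by simp
  qed
  then have "1 / u T \<ge> 0" by (simp add: T_def field_simps)
  then show False using neg[OF \<open>t\<^sub>0 \<le> T\<close>] by (simp add: zero_le_divide_iff)
qed

text \<open>Time reversal \<open>y(t) \<mapsto> - y(-t)\<close>. The change of sign in the value compensates for the change of
  sign in the derivative, so that the squared term of a Riccati equation keeps its negative sign.\<close>

lemma solution_on_reverse:
  assumes "solution_on h I x"
  shows "solution_on (\<lambda>t y. h (- t) (- y)) (uminus ` I) (\<lambda>t. - x (- t))"
  unfolding solution_on_def
proof (intro conjI ballI)
  show "open (uminus ` I)" "is_interval (uminus ` I)"
    using assms by (auto simp: solution_on_def open_negations)
  fix t assume "t \<in> uminus ` I"
  then have "(x has_real_derivative h (- t) (x (- t))) (at (- t))"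
    using assms by (auto simp: solution_on_def)
  then have "((\<lambda>t. x (- t)) has_real_derivative - h (- t) (x (- t))) (at t)"
    by (simp add: DERIV_mirror)
  from DERIV_minus[OF this] show "((\<lambda>t. - x (- t)) has_real_derivative h (- t) (- (- x (- t)))) (at t)"
    by simp
qed

lemma shifted_riccati_reverse:
  "(\<lambda>t y. shifted_riccati g p (- t) (- y)) = shifted_riccati (\<lambda>t. - g (- t)) (\<lambda>t. p (- t))"
proof -
  have "(- y - g (- t))\<^sup>2 = (y - - g (- t))\<^sup>2" for t y
    by (simp add: power2_eq_square algebra_simps)
  then show ?thesis by (simp add: shifted_riccati_def fun_eq_iff)
qed

lemma global_solution_reverse:
  "solution_on (shifted_riccati (\<lambda>t. - g (- t)) (\<lambda>t. p (- t))) UNIV (\<lambda>t. - y (- t)) \<longleftrightarrow>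
   solution_on (shifted_riccati g p) UNIV y"
  using solution_on_reverse[of "shifted_riccati g p" UNIV y, unfolded shifted_riccati_reverse]
    solution_on_reverse[of "shifted_riccati (\<lambda>t. - g (- t)) (\<lambda>t. p (- t))" UNIV "\<lambda>t. - y (- t)",
      unfolded shifted_riccati_reverse]
  by (auto simp: surj_uminus)

lemma max_interval_reverse:
  "max_interval (shifted_riccati (\<lambda>t. - g (- t)) (\<lambda>t. p (- t))) (- s) (- y0) =
   uminus ` max_interval (shifted_riccati g p) s y0"
proof -
  have sub: "uminus ` max_interval (shifted_riccati g p) s y0 \<subseteq>
      max_interval (shifted_riccati (\<lambda>t. - g (- t)) (\<lambda>t. p (- t))) (- s) (- y0)" for g p s y0
  proof safe
    fix t assume "t \<in> max_interval (shifted_riccati g p) s y0"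
    then obtain I x where "solution_on (shifted_riccati g p) I x" "s \<in> I" "t \<in> I" "x s = y0"
      by (rule max_intervalE)
    then show "- t \<in> max_interval (shifted_riccati (\<lambda>t. - g (- t)) (\<lambda>t. p (- t))) (- s) (- y0)"
      using max_intervalI[OF solution_on_reverse[of "shifted_riccati g p" I x, unfolded shifted_riccati_reverse],
          of "- s" "- t"] by auto
  qed
  have "uminus ` max_interval (shifted_riccati (\<lambda>t. - g (- t)) (\<lambda>t. p (- t))) (- s) (- y0)
      \<subseteq> max_interval (shifted_riccati g p) s y0"
    using sub[of "\<lambda>t. - g (- t)" "\<lambda>t. p (- t)" "- s" "- y0"] by simp
  then have "uminus ` uminus ` max_interval (shifted_riccati (\<lambda>t. - g (- t)) (\<lambda>t. p (- t))) (- s) (- y0)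
      \<subseteq> uminus ` max_interval (shifted_riccati g p) s y0"
    by (rule image_mono)
  with sub[of g p s y0] show ?thesis
    by (auto simp: image_image)
qed

text \<open>The restriction to the maximal interval matters: elsewhere \<open>max_solution\<close> is an unspecified
  value, which reversal need not respect.\<close>

lemma max_solution_reverse:
  assumes "continuous_on UNIV g" and t: "t \<in> max_interval (shifted_riccati g p) s y0"
  shows "max_solution (shifted_riccati (\<lambda>t. - g (- t)) (\<lambda>t. p (- t))) (- s) (- y0) (- t) =
    - max_solution (shifted_riccati g p) s y0 t"
proof -
  from t obtain I x where x: "solution_on (shifted_riccati g p) I x" "s \<in> I" "t \<in> I" "x s = y0"
    by (rule max_intervalE)
  have "continuous_on UNIV (\<lambda>t. - g (- t))"
    using assms(1) by (intro continuous_intros continuous_on_compose2[OF assms(1)]) auto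
  from max_solution_eq[OF this solution_on_reverse[OF x(1), unfolded shifted_riccati_reverse], of "- s" "- t"]
    max_solution_eq[OF assms(1) x(1-3)] x
  show ?thesis by auto
qed

lemma right_part_reverse:
  assumes "continuous_on UNIV g"
  shows "right_part (shifted_riccati g p) s y0 =
    uminus ` left_part (shifted_riccati (\<lambda>t. - g (- t)) (\<lambda>t. p (- t))) (- s) (- y0)"
proof -
  have "left_part (shifted_riccati (\<lambda>t. - g (- t)) (\<lambda>t. p (- t))) (- s) (- y0) =
    (\<lambda>t. max_solution (shifted_riccati (\<lambda>t. - g (- t)) (\<lambda>t. p (- t))) (- s) (- y0) (- t)) `
      (max_interval (shifted_riccati g p) s y0 \<inter> {s..})"
    unfolding left_part_def max_interval_reverse by (auto simp: image_iff)
  also have "\<dots> = (\<lambda>t. - max_solution (shifted_riccati g p) s y0 t) `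
      (max_interval (shifted_riccati g p) s y0 \<inter> {s..})"
    by (intro image_cong refl max_solution_reverse assms) auto
  finally show ?thesis
    by (simp add: right_part_def image_image)
qed

lemma bounded_of_global_solution:
  assumes "bounded (range g)" "bounded (range p)" and y: "solution_on (shifted_riccati g p) UNIV y"
  shows "bounded (range y)"
proof -
  obtain N where N: "\<And>t. \<bar>g t\<bar> \<le> N" using assms(1) by (auto simp: bounded_iff)
  obtain M where M: "\<And>t. \<bar>p t\<bar> \<le> M" using assms(2) by (auto simp: bounded_iff)
  have "- sqrt (2 * (N\<^sup>2 + M)) \<le> y t" for t
    using bounded_below_of_global_solution[OF N M y] .
  moreover have "- sqrt (2 * (N\<^sup>2 + M)) \<le> - y (- t)" for t
    using bounded_below_of_global_solution[OF _ _ y[THEN global_solution_reverse[THEN iffD2]]] N M by simp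
  from this[of "- t" for t] have "y t \<le> sqrt (2 * (N\<^sup>2 + M))" for t by simp
  ultimately have "\<bar>y t\<bar> \<le> sqrt (2 * (N\<^sup>2 + M))" for t
    by (metis abs_le_iff minus_le_iff)
  then show ?thesis
    by (auto simp: bounded_iff)
qed

section \<open>Hyperbolic solutions\<close>

text \<open>Hyperbolicity is restated through an antiderivative \<open>G\<close> of \<open>2 (b - g)\<close>, which turns time reversal
  into the substitution \<open>t \<mapsto> - t\<close> in \<open>G\<close> and avoids transforming integrals.\<close>

lemma integral_deriv_shifted_riccati:
  assumes g: "continuous_on UNIV g" and b: "continuous_on UNIV b"
    and G: "\<And>t. (G has_real_derivative 2 * (b t - g t)) (at t)"
  shows "(LBINT l=ereal s..ereal t. deriv (shifted_riccati g p l) (b l)) = G s - G t"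
proof -
  have "(LBINT l=ereal s..ereal t. - (2 * (b l - g l))) = - G t - - G s"
  proof (rule interval_integral_FTC_finite)
    show "continuous_on {min s t..max s t} (\<lambda>l. - (2 * (b l - g l)))"
      by (intro continuous_intros continuous_on_subset[OF g] continuous_on_subset[OF b]) auto
    show "((\<lambda>t. - G t) has_vector_derivative - (2 * (b x - g x))) (at x within {min s t..max s t})" for x
      using DERIV_minus[OF G[of x]]
      by (simp add: has_real_derivative_iff_has_vector_derivative has_vector_derivative_at_within)
  qed
  then show ?thesis by (simp add: deriv_shifted_riccati)
qed

lemma attractive_hyperbolic_iff:
  assumes g: "continuous_on UNIV g" and b: "solution_on (shifted_riccati g p) UNIV b"
    and G: "\<And>t. (G has_real_derivative 2 * (b t - g t)) (at t)"
  shows "attractive_hyperbolic (shifted_riccati g p) b \<longleftrightarrow> exp_stable G"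
  using b unfolding attractive_hyperbolic_def exp_stable_def
    integral_deriv_shifted_riccati[OF g solution_continuous_on[OF b] G] by simp

lemma repulsive_hyperbolic_iff:
  assumes g: "continuous_on UNIV g" and b: "solution_on (shifted_riccati g p) UNIV b"
    and G: "\<And>t. (G has_real_derivative 2 * (b t - g t)) (at t)"
  shows "repulsive_hyperbolic (shifted_riccati g p) b \<longleftrightarrow> exp_stable (\<lambda>t. G (- t))"
proof -
  have "(\<forall>s t. t \<le> s \<longrightarrow> exp (G s - G t) \<le> k * exp (\<beta> * (t - s))) \<longleftrightarrow>
      (\<forall>s t. s \<le> t \<longrightarrow> exp (G (- s) - G (- t)) \<le> k * exp (- \<beta> * (t - s)))" for k \<beta>
  proof safe
    fix s t :: real
    assume *: "\<forall>s t. t \<le> s \<longrightarrow> exp (G s - G t) \<le> k * exp (\<beta> * (t - s))" and "s \<le> t"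
    then show "exp (G (- s) - G (- t)) \<le> k * exp (- \<beta> * (t - s))"
      using *[rule_format, of "- t" "- s"] by (simp add: algebra_simps)
  next
    fix s t :: real
    assume *: "\<forall>s t. s \<le> t \<longrightarrow> exp (G (- s) - G (- t)) \<le> k * exp (- \<beta> * (t - s))" and "t \<le> s"
    then show "exp (G s - G t) \<le> k * exp (\<beta> * (t - s))"
      using *[rule_format, of "- s" "- t"] by (simp add: algebra_simps)
  qed
  then show ?thesis
  using b unfolding repulsive_hyperbolic_def exp_stable_def
    integral_deriv_shifted_riccati[OF g solution_continuous_on[OF b] G] by simp
qed

lemma shift_antiderivative:
  assumes "continuous_on UNIV g" "solution_on h UNIV b"
  obtains G where "\<And>t. (G has_real_derivative 2 * (b t - g t)) (at t)"
  by (rule antiderivative_on_UNIV[of "\<lambda>t. 2 * (b t - g t)"])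
    (intro continuous_intros assms(1) solution_continuous_on[OF assms(2)], rule that)

lemma repulsive_iff_reverse_attractive:
  assumes g: "continuous_on UNIV g"
  shows "repulsive_hyperbolic (shifted_riccati g p) b \<longleftrightarrow>
    attractive_hyperbolic (shifted_riccati (\<lambda>t. - g (- t)) (\<lambda>t. p (- t))) (\<lambda>t. - b (- t))"
proof (cases "solution_on (shifted_riccati g p) UNIV b")
  case True
  obtain G where G: "\<And>t. (G has_real_derivative 2 * (b t - g t)) (at t)"
    using shift_antiderivative[OF g True] by blast
  have "continuous_on UNIV (\<lambda>t. - g (- t))"
    by (intro continuous_intros continuous_on_compose2[OF g]) auto
  moreover have "((\<lambda>t. G (- t)) has_real_derivative 2 * (- b (- t) - - g (- t))) (at t)" for t
    using G[of "- t"] by (simp add: DERIV_mirror)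
  ultimately show ?thesis
    using attractive_hyperbolic_iff repulsive_hyperbolic_iff[OF g True G]
      global_solution_reverse[of g p b] True by blast
next
  case False
  then show ?thesis
    using global_solution_reverse[of g p b]
    by (simp add: attractive_hyperbolic_def repulsive_hyperbolic_def)
qed

section \<open>The phase portrait of an attractive hyperbolic solution\<close>

text \<open>An attractive solution \<open>b\<close> with the two quadratures that solve the equation. \<open>H\<close> is minus the
  integral of \<open>exp (- G)\<close> from \<open>t\<close> to \<open>+\<infinity>\<close>, and \<open>H_bound\<close> is the integrated form of attractivity.\<close>

locale attractive_frame =
  fixes g p b G H :: "real \<Rightarrow> real" and \<delta> :: real
  assumes g_cont: "continuous_on UNIV g"
    and b_sol: "solution_on (shifted_riccati g p) UNIV b"
    and G_deriv: "(G has_real_derivative 2 * (b t - g t)) (at t)"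
    and G_lim: "((\<lambda>t. exp (- G t)) \<longlongrightarrow> 0) at_top"
    and H_deriv: "(H has_real_derivative exp (- G t)) (at t)"
    and H_neg: "H t < 0"
    and \<delta>_pos: "\<delta> > 0"
    and H_bound: "\<delta> * - H t \<le> exp (- G t)"
begin

text \<open>The general solution, up to \<open>b\<close> itself, which corresponds to \<open>C = \<infinity>\<close>.\<close>

definition sol :: "real \<Rightarrow> real \<Rightarrow> real" where
  "sol C t = b t + exp (- G t) / (C + H t)"

abbreviation "r \<equiv> sol 0"

lemma solution_sol:
  assumes "open I" "is_interval I" "\<And>t. t \<in> I \<Longrightarrow> C + H t \<noteq> 0"
  shows "solution_on (shifted_riccati g p) I (sol C)"
  unfolding solution_on_def
proof (intro conjI ballI assms(1,2))
  fix t assume "t \<in> I"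
  then have nz: "C + H t \<noteq> 0" by (rule assms(3))
  define u where "u = exp (- G t) / (C + H t)"
  have b: "(b has_real_derivative shifted_riccati g p t (b t)) (at t)"
    using b_sol by (simp add: solution_on_def)
  have "(sol C has_real_derivative shifted_riccati g p t (b t)
      + (exp (- G t) * - (2 * (b t - g t)) * (C + H t) - exp (- G t) * exp (- G t))
        / ((C + H t) * (C + H t))) (at t)"
    unfolding sol_def[abs_def]
    by (rule derivative_eq_intros b G_deriv H_deriv nz refl)+ simp
  also have "(exp (- G t) * - (2 * (b t - g t)) * (C + H t) - exp (- G t) * exp (- G t))
        / ((C + H t) * (C + H t)) = - (2 * (b t - g t)) * u - u * u"
    using nz by (simp add: u_def diff_divide_distrib)
  also have "shifted_riccati g p t (b t) + (- (2 * (b t - g t)) * u - u * u)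
      = shifted_riccati g p t (sol C t)"
    by (simp add: shifted_riccati_def sol_def u_def[symmetric] power2_eq_square algebra_simps)
  finally show "(sol C has_real_derivative shifted_riccati g p t (sol C t)) (at t)" .
qed

lemma H_less: "s < t \<Longrightarrow> H s < H t"
  by (rule DERIV_pos_imp_increasing) (auto intro: H_deriv exI[where x="exp _"])

lemma H_mono: "s \<le> t \<Longrightarrow> H s \<le> H t"
  using H_less[of s t] by (cases "s = t") auto

lemma H_cont: "continuous_on A H"
  using H_deriv by (meson DERIV_isCont continuous_at_imp_continuous_on)

text \<open>By \<open>H_bound\<close>, the positive function \<open>- H\<close> has logarithmic derivative \<open>exp (- G) / H \<le> - \<delta>\<close>.\<close>

lemma H_decay:
  assumes "s \<le> t" shows "- H t \<le> - H s * exp (- \<delta> * (t - s))"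
proof -
  have "- H t * exp (\<delta> * t) \<le> - H s * exp (\<delta> * s)"
  proof (rule DERIV_nonpos_imp_nonincreasing[OF assms], intro exI conjI)
    fix x
    show "((\<lambda>t. - H t * exp (\<delta> * t)) has_real_derivative (\<delta> * - H x - exp (- G x)) * exp (\<delta> * x)) (at x)"
      by (auto intro!: derivative_eq_intros H_deriv simp: algebra_simps)
    show "(\<delta> * - H x - exp (- G x)) * exp (\<delta> * x) \<le> 0"
      using H_bound[of x] by (simp add: mult_le_0_iff)
  qed
  then have "- H t * exp (\<delta> * t) \<le> (- H s * exp (- \<delta> * (t - s))) * exp (\<delta> * t)"
    by (simp add: algebra_simps flip: exp_add)
  then show ?thesis by simp
qed

text \<open>The exponential growth of \<open>- H\<close> in the past makes \<open>H\<close> reach every negative value. At the resulting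
  time the denominator of \<open>sol C\<close> vanishes, which is where that solution blows up.\<close>

lemma H_attains:
  assumes "C + H s > 0" "C > 0"
  obtains t0 where "t0 < s" "C + H t0 = 0"
proof -
  \<comment> \<open>Chosen so that \<open>1 + \<delta> (s - s1)\<close>, a lower bound for the growth factor, exceeds \<open>C / - H s\<close>.\<close>
  define s1 where "s1 = s - C / (\<delta> * - H s)"
  have "s1 \<le> s" using assms(2) H_neg[of s] \<delta>_pos by (simp add: s1_def mult_pos_neg mult_le_0_iff divide_le_0_iff)
  have "\<delta> * (s - s1) = C / - H s"
    using \<delta>_pos H_neg[of s] by (simp add: s1_def field_simps)
  then have "exp (\<delta> * (s - s1)) \<ge> C / - H s"
    using exp_ge_add_one_self[of "\<delta> * (s - s1)"] by linarith
  then have "C \<le> - H s * exp (\<delta> * (s - s1))"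
    using H_neg[of s] by (simp add: field_simps)
  also have "\<dots> \<le> (- H s1 * exp (- \<delta> * (s - s1))) * exp (\<delta> * (s - s1))"
    using H_decay[OF \<open>s1 \<le> s\<close>] by (intro mult_right_mono) auto
  also have "\<dots> = - H s1" by (simp flip: exp_add)
  finally have "H s1 \<le> - C" by simp
  then obtain t0 where t0: "s1 \<le> t0" "t0 \<le> s" "H t0 = - C"
    using IVT'[of H s1 "- C" s] assms \<open>s1 \<le> s\<close> H_cont by auto
  then show ?thesis
    using assms by (intro that[of t0]) (cases "t0 = s", auto)
qed

lemma sol_through:
  assumes "y0 \<noteq> b s" and C: "C = exp (- G s) / (y0 - b s) - H s"
  shows "sol C s = y0" "C + H s \<noteq> 0" "C + H s > 0 \<longleftrightarrow> y0 > b s"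
  using assms by (auto simp: sol_def zero_less_divide_iff)

lemma r_less_b: "r t < b t"
  using H_neg[of t] by (simp add: sol_def divide_pos_neg)

text \<open>Above \<open>b\<close> the denominator \<open>C + H\<close> is positive at \<open>s\<close> and increases; between \<open>r\<close> and \<open>b\<close> it stays
  below \<open>C < 0\<close>. In both cases it is bounded away from \<open>0\<close> on \<open>{s..}\<close>, so the solution exists there
  and its distance to \<open>b\<close> is at most a multiple of \<open>exp (- G)\<close>.\<close>

lemma forward_attraction:
  assumes "y0 > r s"
  shows "{s..} \<subseteq> max_interval (shifted_riccati g p) s y0"
    and "((\<lambda>t. \<bar>b t - max_solution (shifted_riccati g p) s y0 t\<bar>) \<longlongrightarrow> 0) at_top"
proof -
  have "{s..} \<subseteq> max_interval (shifted_riccati g p) s y0 \<and>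
      ((\<lambda>t. \<bar>b t - max_solution (shifted_riccati g p) s y0 t\<bar>) \<longlongrightarrow> 0) at_top"
  proof (cases "y0 = b s")
    case True
    then show ?thesis
      using max_intervalI[OF b_sol] max_solution_eq[OF g_cont b_sol] by auto
  next
    case False
    define C where "C = exp (- G s) / (y0 - b s) - H s"
    note C = sol_through[OF False C_def]
    obtain J \<mu> where J: "open J" "is_interval J" "\<And>t. t \<in> J \<Longrightarrow> C + H t \<noteq> 0" "{s..} \<subseteq> J"
      and \<mu>: "\<mu> > 0" "\<And>t. t \<ge> s \<Longrightarrow> \<mu> \<le> \<bar>C + H t\<bar>"
    proof (cases "y0 > b s")
      case True
      then have pos: "C + H s > 0" using C(3) by simp
      have "open {t. C + H t > 0}"
        by (intro open_Collect_less continuous_intros H_cont)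
      moreover have "is_interval {t. C + H t > 0}"
        unfolding is_interval_1 using H_mono by (auto intro: less_le_trans)
      moreover have "C + H s \<le> C + H t" if "t \<ge> s" for t
        using H_mono[OF that] by simp
      ultimately show ?thesis
        using pos by (intro that[of "{t. C + H t > 0}" "C + H s"]) force+
    next
      case ngt: False
      then have "y0 - b s < 0" using False by simp
      moreover have "exp (- G s) / H s < y0 - b s" using assms by (simp add: sol_def)
      ultimately have "C < 0"
        using H_neg[of s] by (simp add: C_def field_simps)
      moreover have "C + H t < C" for t using H_neg[of t] by simp
      ultimately show ?thesis
        by (intro that[of UNIV "- C"]) (simp_all add: add_neg_neg less_imp_neq, smt (verit))
    qed
    note S = solution_sol[OF J(1-3)]
    have sJ: "s \<in> J" using J(4) by auto
    have eq: "max_solution (shifted_riccati g p) s y0 t = sol C t" if "t \<ge> s" for t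
      using max_solution_eq[OF g_cont S sJ, of t] J(4) that C(1) by auto
    have "((\<lambda>t. \<bar>b t - max_solution (shifted_riccati g p) s y0 t\<bar>) \<longlongrightarrow> 0) at_top"
    proof (rule tendsto_sandwich[of "\<lambda>_. 0"])
      show "((\<lambda>t. exp (- G t) / \<mu>) \<longlongrightarrow> 0) at_top"
        using tendsto_divide[OF G_lim tendsto_const[of \<mu>]] \<mu> by simp
      show "\<forall>\<^sub>F t in at_top. \<bar>b t - max_solution (shifted_riccati g p) s y0 t\<bar> \<le> exp (- G t) / \<mu>"
        using eventually_ge_at_top[of s]
      proof eventually_elim
        case (elim t)
        then show ?case
          using \<mu> by (auto simp: eq sol_def abs_divide intro!: divide_left_mono mult_pos_pos
              intro: less_le_trans)
      qed
    qed auto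
    moreover have "{s..} \<subseteq> max_interval (shifted_riccati g p) s y0"
      using max_intervalI[OF S sJ] J(4) C(1) by auto
    ultimately show ?thesis by blast
  qed
  then show "{s..} \<subseteq> max_interval (shifted_riccati g p) s y0"
    "((\<lambda>t. \<bar>b t - max_solution (shifted_riccati g p) s y0 t\<bar>) \<longlongrightarrow> 0) at_top" by auto
qed

text \<open>Solutions do not cross, so one that starts below \<open>b\<close> has the bounded function \<open>b\<close> as a barrier.\<close>

lemma left_part_bdd_above:
  assumes "bounded (range b)" "y0 \<le> b s"
  shows "bdd_above (left_part (shifted_riccati g p) s y0)"
proof -
  obtain B where B: "\<And>t. b t \<le> B"
    using assms(1) by (auto simp: bounded_iff abs_le_iff)
  have "max_solution (shifted_riccati g p) s y0 t \<le> B"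
    if t: "t \<in> max_interval (shifted_riccati g p) s y0" for t
  proof -
    from t obtain I x where x: "solution_on (shifted_riccati g p) I x" "s \<in> I" "t \<in> I" "x s = y0"
      by (rule max_intervalE)
    have "solution_on (shifted_riccati g p) I b"
      using b_sol x(1) by (auto simp: solution_on_def)
    then obtain k where "k > 0" "x t - b t = k * (x s - b s)"
      using solution_difference_scaling[OF g_cont x(1) _ x(2,3)] by blast
    then have "x t - b t \<le> 0"
      using assms(2) x(4) by (simp add: mult_nonneg_nonpos)
    then have "x t \<le> b t" by simp
    then show ?thesis
      using max_solution_eq[OF g_cont x(1-3)] x(4) B[of t] by simp
  qed
  then show ?thesis
    unfolding left_part_def by (auto intro!: bdd_aboveI)
qed

text \<open>The distance to \<open>b\<close> is \<open>1 / w\<close> with \<open>w = (C + H) exp G\<close>. Since \<open>w\<close> vanishes at the blow-up time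
  \<open>t0 < s\<close>, it takes every small positive value \<open>1 / N\<close> between \<open>t0\<close> and \<open>s\<close>.\<close>

lemma left_part_not_bdd_above:
  assumes "bounded (range b)" "y0 > b s"
  shows "\<not> bdd_above (left_part (shifted_riccati g p) s y0)"
proof
  assume "bdd_above (left_part (shifted_riccati g p) s y0)"
  then obtain M where M: "\<And>y. y \<in> left_part (shifted_riccati g p) s y0 \<Longrightarrow> y \<le> M"
    by (auto simp: bdd_above_def)
  obtain B where B: "\<And>t. \<bar>b t\<bar> \<le> B"
    using assms(1) by (auto simp: bounded_iff)
  define C where "C = exp (- G s) / (y0 - b s) - H s"
  have C: "sol C s = y0" "C + H s > 0"
    using sol_through[OF _ C_def] assms by auto
  with H_neg[of s] have "C > 0" by linarith
  then obtain t0 where t0: "t0 < s" "C + H t0 = 0"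
    using H_attains C by blast
  define J where "J = {t0<..}"
  have pos: "C + H t > 0" if "t \<in> J" for t
    using H_less[of t0 t] that t0 by (simp add: J_def)
  have S: "solution_on (shifted_riccati g p) J (sol C)"
    by (rule solution_sol) (use pos in \<open>force simp: J_def is_interval_1\<close>)+
  define N where "N = max (\<bar>M\<bar> + B + 1) (exp (- G s) / (C + H s))"
  have "B \<ge> 0" using B[of 0] by linarith
  then have N: "N > 0" "N > M + B" "N \<ge> exp (- G s) / (C + H s)" by (auto simp: N_def)
  define w where "w t = (C + H t) * exp (G t)" for t
  have "w s \<ge> 1 / N"
  proof -
    have "1 / w s \<le> N" using N(3) by (simp add: w_def exp_minus field_simps)
    moreover have "w s > 0" using C(2) by (simp add: w_def)
    ultimately show ?thesis using N(1) by (simp add: field_simps)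
  qed
  moreover have "w t0 \<le> 1 / N" using N t0 by (simp add: w_def)
  moreover have "continuous_on {t0..s} w"
    unfolding w_def
    by (intro continuous_intros H_cont) (meson G_deriv DERIV_isCont continuous_at_imp_continuous_on)
  ultimately obtain t where t: "t0 \<le> t" "t \<le> s" "w t = 1 / N"
    using IVT'[of w t0 "1 / N" s] t0 by auto
  then have "t \<noteq> t0" using t0 N by (auto simp: w_def)
  then have tJ: "t \<in> J" using t by (simp add: J_def)
  have "exp (- G t) / (C + H t) = N"
  proof -
    have "exp (- G t) / (C + H t) = 1 / w t" by (simp add: w_def exp_minus field_simps)
    then show ?thesis using t(3) by simp
  qed
  then have "sol C t > M" using N(2) B[of t] by (simp add: sol_def)
  moreover have "sol C t \<in> left_part (shifted_riccati g p) s y0"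
    unfolding left_part_def
    using max_intervalI[OF S _ tJ, of s] max_solution_eq[OF g_cont S _ tJ, of s] C(1) t t0
    by (auto simp: J_def image_iff intro!: bexI[of _ t])
  ultimately show False using M by fastforce
qed

text \<open>With \<open>D = b - r\<close> one has \<open>exp (- G) = - D H\<close>, and \<open>G + 2 ln (- H)\<close> is an antiderivative of
  \<open>2 (r - g)\<close> whose exponential is therefore \<open>- H / D\<close>. Here \<open>- H\<close> decays exponentially, while \<open>D\<close> lies
  between \<open>\<delta>\<close> and a constant because global solutions are bounded.\<close>

lemma repulsive_r:
  assumes "bounded (range g)" "bounded (range p)"
  shows "repulsive_hyperbolic (shifted_riccati g p) r"
proof -
  have r: "solution_on (shifted_riccati g p) UNIV r"
    by (rule solution_sol) (use H_neg in \<open>auto simp: less_le\<close>)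
  define D where "D t = b t - r t" for t
  have D_H: "D t * - H t = exp (- G t)" for t
    using H_neg[of t] by (simp add: D_def sol_def)
  have D_ge: "\<delta> \<le> D t" for t
    using H_bound[of t] H_neg[of t] unfolding D_H[symmetric] by (simp add: mult_le_cancel_right)
  obtain B where B: "\<And>t. \<bar>b t\<bar> \<le> B"
    using bounded_of_global_solution[OF assms b_sol] by (auto simp: bounded_iff)
  obtain R where R: "\<And>t. \<bar>r t\<bar> \<le> R"
    using bounded_of_global_solution[OF assms r] by (auto simp: bounded_iff)
  have D_le: "D t \<le> B + R" for t
    using B[of t] R[of t] by (simp add: D_def)
  define Gr where "Gr t = G t + 2 * ln (- H t)" for t
  have Gr: "(Gr has_real_derivative 2 * (r t - g t)) (at t)" for t
    unfolding Gr_def using H_neg[of t]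
    by (auto intro!: derivative_eq_intros G_deriv H_deriv simp: sol_def field_simps)
  have exp_Gr: "exp (Gr t) = - H t / D t" for t
  proof -
    have "exp (Gr t) = exp (G t) * (- H t)\<^sup>2"
      using H_neg[of t] by (simp add: Gr_def exp_add exp_double)
    also have "exp (G t) = 1 / (D t * - H t)"
      unfolding D_H by (simp add: exp_minus inverse_eq_divide)
    finally show ?thesis using H_neg[of t] by (simp add: power2_eq_square)
  qed
  have "exp_stable (\<lambda>t. Gr (- t))"
    unfolding exp_stable_def
  proof (intro exI conjI allI impI)
    show "1 \<le> (B + R) / \<delta>" using D_ge[of 0] D_le[of 0] \<delta>_pos by simp
    show "\<delta> > 0" by (fact \<delta>_pos)
    fix s t :: real assume "s \<le> t"
    have "exp (Gr (- s) - Gr (- t)) = D (- t) / D (- s) * (- H (- s) / - H (- t))"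
      by (simp add: exp_diff exp_Gr)
    also have "\<dots> \<le> (B + R) / \<delta> * exp (- \<delta> * (t - s))"
    proof (rule mult_mono)
      have "D t > 0" for t using D_ge[of t] \<delta>_pos by linarith
      moreover have "B + R \<ge> 0" using D_ge[of 0] D_le[of 0] \<delta>_pos by linarith
      ultimately show "D (- t) / D (- s) \<le> (B + R) / \<delta>"
        using D_ge D_le \<delta>_pos by (intro frac_le) auto
      show "0 \<le> (B + R) / \<delta>" using \<delta>_pos \<open>B + R \<ge> 0\<close> by simp
      show "0 \<le> - H (- s) / - H (- t)" using H_neg[of "- s"] H_neg[of "- t"] by (simp add: zero_le_divide_iff)
      show "- H (- s) / - H (- t) \<le> exp (- \<delta> * (t - s))"
        using H_decay[of "- t" "- s"] H_neg[of "- t"] \<open>s \<le> t\<close> by (simp add: field_simps)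
    qed
    finally show "exp (Gr (- s) - Gr (- t)) \<le> (B + R) / \<delta> * exp (- \<delta> * (t - s))" .
  qed
  then show ?thesis
    using repulsive_hyperbolic_iff[OF g_cont r Gr] by simp
qed

end

text \<open>Attractivity bounds the increments of any antiderivative \<open>H0\<close> of \<open>exp (- G)\<close> after time \<open>s\<close> by
  \<open>k / \<beta> * exp (- G s)\<close>. Hence \<open>H0\<close> is bounded above, and subtracting its supremum gives \<open>H\<close>.\<close>

lemma attractive_frame_exists:
  assumes g: "continuous_on UNIV g" and "attractive_hyperbolic (shifted_riccati g p) b"
  obtains G H \<delta> where "attractive_frame g p b G H \<delta>"
proof -
  have b: "solution_on (shifted_riccati g p) UNIV b"
    using assms(2) by (simp add: attractive_hyperbolic_def)
  obtain G where G: "\<And>t. (G has_real_derivative 2 * (b t - g t)) (at t)"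
    using shift_antiderivative[OF g b] by blast
  have "exp_stable G" using assms(2) attractive_hyperbolic_iff[OF g b G] by simp
  then obtain k \<beta> where k: "k \<ge> 1" and \<beta>: "\<beta> > 0"
    and st: "\<And>s t. s \<le> t \<Longrightarrow> exp (G s - G t) \<le> k * exp (- \<beta> * (t - s))"
    unfolding exp_stable_def by blast
  have st': "exp (- G t) \<le> exp (- G s) * (k * exp (- \<beta> * (t - s)))" if "s \<le> t" for s t
  proof -
    have "exp (- G t) = exp (- G s) * exp (G s - G t)" by (simp flip: exp_add)
    also have "\<dots> \<le> exp (- G s) * (k * exp (- \<beta> * (t - s)))" using st[OF that] by simp
    finally show ?thesis .
  qed
  have lim: "((\<lambda>t. exp (- G t)) \<longlongrightarrow> 0) at_top"
  proof (rule tendsto_sandwich[of "\<lambda>_. 0"])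
    have "((\<lambda>t. exp (- G 0) * (k * exp (- \<beta> * t))) \<longlongrightarrow> exp (- G 0) * (k * 0)) at_top"
      using \<beta> by (intro tendsto_intros filterlim_compose[OF exp_at_bot]
          filterlim_tendsto_neg_mult_at_bot[OF tendsto_const] filterlim_ident) auto
    then show "((\<lambda>t. exp (- G 0) * (k * exp (- \<beta> * t))) \<longlongrightarrow> 0) at_top" by simp
    show "\<forall>\<^sub>F t in at_top. exp (- G t) \<le> exp (- G 0) * (k * exp (- \<beta> * t))"
      using eventually_ge_at_top[of 0] by eventually_elim (use st'[of 0] in simp)
  qed auto
  have G_cont: "continuous_on UNIV G"
    using G by (meson DERIV_isCont continuous_at_imp_continuous_on)
  have "continuous_on UNIV (\<lambda>t. exp (- G t))"
    by (intro continuous_intros G_cont)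
  from antiderivative_on_UNIV[OF this] obtain H0 where
    H0: "\<And>t. (H0 has_real_derivative exp (- G t)) (at t)" by blast
  have H0_less: "H0 s < H0 t" if "s < t" for s t
    using that by (rule DERIV_pos_imp_increasing) (auto intro: H0 exI[where x="exp _"])
  have H0_le: "H0 t \<le> H0 s + k / \<beta> * exp (- G s)" for s t
  proof (cases "s \<le> t")
    case True
    define \<phi> where "\<phi> x = - (k / \<beta> * exp (- G s) * exp (- \<beta> * (x - s))) - H0 x" for x
    have "\<phi> s \<le> \<phi> t"
    proof (rule DERIV_nonneg_imp_nondecreasing[OF True], intro exI conjI)
      fix x assume "s \<le> x"
      show "(\<phi> has_real_derivative exp (- G s) * (k * exp (- \<beta> * (x - s))) - exp (- G x)) (at x)"
        unfolding \<phi>_def using \<beta> by (auto intro!: derivative_eq_intros H0)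
      show "0 \<le> exp (- G s) * (k * exp (- \<beta> * (x - s))) - exp (- G x)"
        using st'[OF \<open>s \<le> x\<close>] by simp
    qed
    moreover have "0 \<le> k / \<beta> * exp (- G s) * exp (- \<beta> * (t - s))" using k \<beta> by simp
    ultimately show ?thesis by (simp add: \<phi>_def)
  next
    case False
    moreover have "0 \<le> k / \<beta> * exp (- G s)" using k \<beta> by simp
    ultimately show ?thesis using H0_less[of t s] by linarith
  qed
  then have bdd: "bdd_above (range H0)" by (intro bdd_aboveI) auto
  define H where "H t = H0 t - Sup (range H0)" for t
  show ?thesis
  proof (rule that[of G H "\<beta> / k"], unfold_locales)
    show "(H has_real_derivative exp (- G t)) (at t)" for t
      unfolding H_def by (auto intro!: derivative_eq_intros H0)
    show "H t < 0" for t
      using H0_less[of t "t + 1"] cSup_upper[OF _ bdd, of "H0 (t + 1)"] by (simp add: H_def)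
    have "Sup (range H0) \<le> H0 t + k / \<beta> * exp (- G t)" for t
      using H0_le by (intro cSup_least) auto
    then show "\<beta> / k * - H t \<le> exp (- G t)" for t
      using k \<beta> by (simp add: H_def field_simps)
    show "\<beta> / k > 0" using k \<beta> by simp
  qed (use g b G lim in auto)
qed

text \<open>The consequences of an attractive solution, freed from the auxiliary functions \<open>G\<close> and \<open>H\<close>. The
  first one describes \<open>a s\<close> without reference to \<open>a\<close>, which yields uniqueness.\<close>

lemma attractive_portrait:
  assumes g: "continuous_on UNIV g" and bd: "bounded (range g)" "bounded (range p)"
    and a: "attractive_hyperbolic (shifted_riccati g p) a"
  shows "bdd_above (left_part (shifted_riccati g p) s y0) \<longleftrightarrow> y0 \<le> a s"
    and "\<exists>r. repulsive_hyperbolic (shifted_riccati g p) r \<and> (\<forall>s. r s < a s) \<and>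
      (\<forall>s y0. r s < y0 \<longrightarrow> {s..} \<subseteq> max_interval (shifted_riccati g p) s y0 \<and>
        ((\<lambda>t. \<bar>a t - max_solution (shifted_riccati g p) s y0 t\<bar>) \<longlongrightarrow> 0) at_top)"
proof -
  obtain G H \<delta> where "attractive_frame g p a G H \<delta>"
    using attractive_frame_exists[OF g a] .
  then interpret attractive_frame g p a G H \<delta> .
  have "bounded (range a)" by (rule bounded_of_global_solution[OF bd b_sol])
  then show "bdd_above (left_part (shifted_riccati g p) s y0) \<longleftrightarrow> y0 \<le> a s"
    using left_part_bdd_above[of y0 s] left_part_not_bdd_above[of s y0] by (cases "y0 \<le> a s") auto
  show "\<exists>r. repulsive_hyperbolic (shifted_riccati g p) r \<and> (\<forall>s. r s < a s) \<and>
      (\<forall>s y0. r s < y0 \<longrightarrow> {s..} \<subseteq> max_interval (shifted_riccati g p) s y0 \<and>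
        ((\<lambda>t. \<bar>a t - max_solution (shifted_riccati g p) s y0 t\<bar>) \<longlongrightarrow> 0) at_top)"
  proof (rule exI[of _ "sol 0"], intro conjI allI impI)
    show "repulsive_hyperbolic (shifted_riccati g p) (sol 0)" by (rule repulsive_r[OF bd])
    show "sol 0 s < a s" for s by (rule r_less_b)
  qed (rule forward_attraction; assumption)+
qed

text \<open>The image of \<open>attractive_portrait\<close> under time reversal.\<close>

lemma repulsive_portrait:
  assumes g: "continuous_on UNIV g" and bd: "bounded (range g)" "bounded (range p)"
    and r: "repulsive_hyperbolic (shifted_riccati g p) r"
  shows "bdd_below (right_part (shifted_riccati g p) s y0) \<longleftrightarrow> r s \<le> y0"
    and "\<exists>a. attractive_hyperbolic (shifted_riccati g p) a \<and> (\<forall>s. r s < a s) \<and>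
      (\<forall>s y0. y0 < a s \<longrightarrow> {..s} \<subseteq> max_interval (shifted_riccati g p) s y0 \<and>
        ((\<lambda>t. \<bar>r t - max_solution (shifted_riccati g p) s y0 t\<bar>) \<longlongrightarrow> 0) at_bot)"
proof -
  define g' p' where "g' t = - g (- t)" and "p' t = p (- t)" for t
  have g': "continuous_on UNIV g'"
    unfolding g'_def by (intro continuous_intros continuous_on_compose2[OF g]) auto
  have bd': "bounded (range g')" "bounded (range p')"
    using bd unfolding g'_def p'_def by (auto simp: bounded_iff)
  have r': "attractive_hyperbolic (shifted_riccati g' p') (\<lambda>t. - r (- t))"
    using r repulsive_iff_reverse_attractive[OF g, of p r] unfolding g'_def p'_def by simp
  note portrait = attractive_portrait[OF g' bd' r']
  show "bdd_below (right_part (shifted_riccati g p) s y0) \<longleftrightarrow> r s \<le> y0"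
    using portrait(1)[of "- s" "- y0"] unfolding right_part_reverse[OF g, of p s y0] g'_def p'_def
    by (simp add: bdd_below_uminus)
  obtain a' where a': "repulsive_hyperbolic (shifted_riccati g' p') a'"
    "\<And>s. a' s < - r (- s)"
    "\<And>s y0. a' s < y0 \<Longrightarrow> {s..} \<subseteq> max_interval (shifted_riccati g' p') s y0"
    "\<And>s y0. a' s < y0 \<Longrightarrow>
      ((\<lambda>t. \<bar>- r (- t) - max_solution (shifted_riccati g' p') s y0 t\<bar>) \<longlongrightarrow> 0) at_top"
    using portrait(2) by blast
  show "\<exists>a. attractive_hyperbolic (shifted_riccati g p) a \<and> (\<forall>s. r s < a s) \<and>
      (\<forall>s y0. y0 < a s \<longrightarrow> {..s} \<subseteq> max_interval (shifted_riccati g p) s y0 \<and>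
        ((\<lambda>t. \<bar>r t - max_solution (shifted_riccati g p) s y0 t\<bar>) \<longlongrightarrow> 0) at_bot)"
  proof (intro exI[of _ "\<lambda>t. - a' (- t)"] conjI allI impI)
    show "attractive_hyperbolic (shifted_riccati g p) (\<lambda>t. - a' (- t))"
      using a'(1) repulsive_iff_reverse_attractive[OF g', of p' a'] by (simp add: g'_def p'_def)
    show "r s < - a' (- s)" for s using a'(2)[of "- s"] by simp
    fix s y0 assume "y0 < - a' (- s)"
    then have less: "a' (- s) < - y0" by simp
    have int: "max_interval (shifted_riccati g' p') (- s) (- y0) =
        uminus ` max_interval (shifted_riccati g p) s y0"
      unfolding g'_def p'_def by (rule max_interval_reverse)
    show sub: "{..s} \<subseteq> max_interval (shifted_riccati g p) s y0"
    proof
      fix t assume "t \<in> {..s}"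
      then have "- t \<in> max_interval (shifted_riccati g' p') (- s) (- y0)"
        using a'(3)[OF less] by auto
      then show "t \<in> max_interval (shifted_riccati g p) s y0" unfolding int by auto
    qed
    have eq: "max_solution (shifted_riccati g' p') (- s) (- y0) (- t) =
        - max_solution (shifted_riccati g p) s y0 t" if "t \<le> s" for t
      unfolding g'_def p'_def using max_solution_reverse[OF g] sub that by blast
    have lim: "((\<lambda>t. \<bar>- r (- (- t)) - max_solution (shifted_riccati g' p') (- s) (- y0) (- t)\<bar>) \<longlongrightarrow> 0) at_bot"
      using filterlim_compose[OF a'(4)[OF less] filterlim_uminus_at_top_at_bot] .
    show "((\<lambda>t. \<bar>r t - max_solution (shifted_riccati g p) s y0 t\<bar>) \<longlongrightarrow> 0) at_bot"
    proof (rule Lim_transform_eventually[OF lim])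
      show "\<forall>\<^sub>F t in at_bot. \<bar>- r (- (- t)) - max_solution (shifted_riccati g' p') (- s) (- y0) (- t)\<bar>
          = \<bar>r t - max_solution (shifted_riccati g p) s y0 t\<bar>"
        using eventually_le_at_bot[of s] by eventually_elim (simp add: eq)
    qed
  qed
qed

lemma attractive_unique:
  assumes "continuous_on UNIV g" "bounded (range g)" "bounded (range p)"
    and "attractive_hyperbolic (shifted_riccati g p) a" "attractive_hyperbolic (shifted_riccati g p) b"
  shows "a = b"
proof
  fix s
  have "a s \<le> b s" "b s \<le> a s"
    using attractive_portrait(1)[OF assms(1-3) assms(4), of s] attractive_portrait(1)[OF assms(1-3) assms(5), of s]
    by (metis order_refl)+
  then show "a s = b s" by simp
qed

lemma repulsive_unique:
  assumes "continuous_on UNIV g" "bounded (range g)" "bounded (range p)"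
    and "repulsive_hyperbolic (shifted_riccati g p) a" "repulsive_hyperbolic (shifted_riccati g p) b"
  shows "a = b"
proof
  fix s
  have "a s \<le> b s" "b s \<le> a s"
    using repulsive_portrait(1)[OF assms(1-3) assms(4), of s] repulsive_portrait(1)[OF assms(1-3) assms(5), of s]
    by (metis order_refl)+
  then show "a s = b s" by simp
qed

lemma attractive_repulsive_pair:
  assumes g: "continuous_on UNIV g" and bd: "bounded (range g)" "bounded (range p)"
    and "hyperbolic (shifted_riccati g p) b"
  obtains a r where "attractive_hyperbolic (shifted_riccati g p) a"
    "repulsive_hyperbolic (shifted_riccati g p) r" "\<And>s. r s < a s"
  using assms(4) attractive_portrait(2)[OF g bd] repulsive_portrait(2)[OF g bd] that
  unfolding hyperbolic_def by blast

section \<open>Asymptotics\<close>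

text \<open>Subtracting \<open>g\<close> from \<open>a\<close> moves the shift into the forcing term: \<open>a - g\<close> solves the unshifted
  equation with \<open>p - g'\<close> in place of \<open>p\<close>. The difference to \<open>b\<close> is then governed by a stable linear
  equation with forcing \<open>- g'\<close>.\<close>

lemma attractive_shift_asymptotics:
  assumes g: "\<And>t. (g has_real_derivative g' t) (at t)" and bd: "bounded (range g)" "bounded (range p)"
    and a: "attractive_hyperbolic (shifted_riccati g p) a"
    and b: "attractive_hyperbolic (shifted_riccati (\<lambda>_. 0) p) b"
  shows "(g' \<longlongrightarrow> 0) at_top \<Longrightarrow> ((\<lambda>t. a t - g t - b t) \<longlongrightarrow> 0) at_top"
    and "(g' \<longlongrightarrow> 0) at_bot \<Longrightarrow> ((\<lambda>t. a t - g t - b t) \<longlongrightarrow> 0) at_bot"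
proof -
  have g_cont: "continuous_on UNIV g"
    using g by (meson DERIV_isCont continuous_at_imp_continuous_on)
  have a_sol: "solution_on (shifted_riccati g p) UNIV a" using a by (simp add: attractive_hyperbolic_def)
  have b_sol: "solution_on (shifted_riccati (\<lambda>_. 0) p) UNIV b" using b by (simp add: attractive_hyperbolic_def)
  obtain G1 where G1: "\<And>t. (G1 has_real_derivative 2 * (a t - g t)) (at t)"
    using shift_antiderivative[OF g_cont a_sol] by blast
  obtain G2 where G2: "\<And>t. (G2 has_real_derivative 2 * (b t - 0)) (at t)"
    using shift_antiderivative[OF continuous_on_const b_sol] by blast
  have "exp_stable G1" using attractive_hyperbolic_iff[OF g_cont a_sol G1] a by simp
  moreover have "exp_stable G2" using attractive_hyperbolic_iff[OF continuous_on_const b_sol G2] b by simp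
  ultimately have stable: "exp_stable (\<lambda>t. (G1 t + G2 t) / 2)" by (rule exp_stable_mean)
  have F: "((\<lambda>t. (G1 t + G2 t) / 2) has_real_derivative a t - g t + b t) (at t)" for t
    by (auto intro!: derivative_eq_intros G1 G2)
  have v: "((\<lambda>t. a t - g t - b t) has_real_derivative
      - (a t - g t + b t) * (a t - g t - b t) + - g' t) (at t)" for t
  proof -
    have "((\<lambda>t. a t - g t - b t) has_real_derivative
        shifted_riccati g p t (a t) - g' t - shifted_riccati (\<lambda>_. 0) p t (b t)) (at t)"
      using a_sol b_sol by (intro DERIV_diff g) (auto simp: solution_on_def)
    then show ?thesis by (simp add: shifted_riccati_def power2_eq_square algebra_simps)
  qed
  have bv: "bounded (range (\<lambda>t. a t - g t - b t))"
    using bounded_of_global_solution[OF bd a_sol] bounded_of_global_solution[OF _ bd(2) b_sol] bd(1)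
    by (intro bounded_minus_comp) auto
  show "((\<lambda>t. a t - g t - b t) \<longlongrightarrow> 0) at_top" if "(g' \<longlongrightarrow> 0) at_top"
    using forced_linear_tendsto_0(1)[OF F stable v bv] tendsto_minus[OF that] by simp
  show "((\<lambda>t. a t - g t - b t) \<longlongrightarrow> 0) at_bot" if "(g' \<longlongrightarrow> 0) at_bot"
    using forced_linear_tendsto_0(2)[OF F stable v bv] tendsto_minus[OF that] by simp
qed

lemma repulsive_shift_asymptotics:
  assumes g: "\<And>t. (g has_real_derivative g' t) (at t)" and bd: "bounded (range g)" "bounded (range p)"
    and a: "repulsive_hyperbolic (shifted_riccati g p) a"
    and b: "repulsive_hyperbolic (shifted_riccati (\<lambda>_. 0) p) b"
  shows "(g' \<longlongrightarrow> 0) at_top \<Longrightarrow> ((\<lambda>t. a t - g t - b t) \<longlongrightarrow> 0) at_top"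
    and "(g' \<longlongrightarrow> 0) at_bot \<Longrightarrow> ((\<lambda>t. a t - g t - b t) \<longlongrightarrow> 0) at_bot"
proof -
  have g_cont: "continuous_on UNIV g"
    using g by (meson DERIV_isCont continuous_at_imp_continuous_on)
  have g_rev: "((\<lambda>t. - g (- t)) has_real_derivative g' (- t)) (at t)" for t
    using DERIV_minus[OF g[of "- t", unfolded DERIV_mirror]] by simp
  have bd': "bounded (range (\<lambda>t. - g (- t)))" "bounded (range (\<lambda>t. p (- t)))"
    using bd by (auto simp: bounded_iff)
  have a': "attractive_hyperbolic (shifted_riccati (\<lambda>t. - g (- t)) (\<lambda>t. p (- t))) (\<lambda>t. - a (- t))"
    using repulsive_iff_reverse_attractive[OF g_cont] a by simp
  have b': "attractive_hyperbolic (shifted_riccati (\<lambda>_. 0) (\<lambda>t. p (- t))) (\<lambda>t. - b (- t))"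
    using repulsive_iff_reverse_attractive[of "\<lambda>_. 0"] b by simp
  note lims = attractive_shift_asymptotics[OF g_rev bd' a' b']
  show "((\<lambda>t. a t - g t - b t) \<longlongrightarrow> 0) at_top" if "(g' \<longlongrightarrow> 0) at_top"
    using tendsto_minus[OF filterlim_compose[OF lims(2)[OF filterlim_compose[OF that filterlim_uminus_at_top_at_bot]]
          filterlim_uminus_at_bot_at_top]]
    by (simp add: algebra_simps)
  show "((\<lambda>t. a t - g t - b t) \<longlongrightarrow> 0) at_bot" if "(g' \<longlongrightarrow> 0) at_bot"
    using tendsto_minus[OF filterlim_compose[OF lims(1)[OF filterlim_compose[OF that filterlim_uminus_at_bot_at_top]]
          filterlim_uminus_at_top_at_bot]]
    by (simp add: algebra_simps)
qed

section \<open>The transition equation\<close>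

definition transition_shift :: "real \<Rightarrow> real \<Rightarrow> real" where
  "transition_shift c t = 2 / pi * arctan (c * t)"

lemma transition_eq_shifted: "transition_eq p c = shifted_riccati (transition_shift c) p"
  by (simp add: fun_eq_iff transition_eq_def shifted_riccati_def transition_shift_def)

lemma riccati_shifted: "riccati p = shifted_riccati (\<lambda>_. 0) p"
  by (simp add: fun_eq_iff riccati_def shifted_riccati_def)

lemma bounded_transition_shift: "bounded (range (transition_shift c))"
proof -
  have "\<bar>transition_shift c t\<bar> \<le> 1" for t
    using arctan_bounded[of "c * t"] by (auto simp: transition_shift_def abs_mult field_simps abs_if)
  then show ?thesis by (auto simp: bounded_iff)
qed

lemma transition_shift_deriv:
  "(transition_shift c has_real_derivative 2 / pi * (c / (1 + (c * t)\<^sup>2))) (at t)"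
proof -
  have "((\<lambda>t. c * t) has_real_derivative c) (at t)"
    by (auto intro!: derivative_eq_intros)
  from DERIV_cmult[OF DERIV_chain2[OF DERIV_arctan this], of "2 / pi"]
  show ?thesis
    by (simp add: transition_shift_def[abs_def] divide_inverse mult_ac)
qed

lemma transition_shift_limits:
  assumes "c > 0"
  shows "(transition_shift c \<longlongrightarrow> 1) at_top" "(transition_shift c \<longlongrightarrow> - 1) at_bot"
    "((\<lambda>t. 2 / pi * (c / (1 + (c * t)\<^sup>2))) \<longlongrightarrow> 0) at_top"
    "((\<lambda>t. 2 / pi * (c / (1 + (c * t)\<^sup>2))) \<longlongrightarrow> 0) at_bot"
proof -
  have top: "filterlim (\<lambda>t. c * t) at_top at_top"
    using assms by (intro filterlim_tendsto_pos_mult_at_top[OF tendsto_const] filterlim_ident) auto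
  have bot: "filterlim (\<lambda>t. c * t) at_bot at_bot"
    using assms by (intro filterlim_tendsto_pos_mult_at_bot[OF tendsto_const] filterlim_ident) auto
  show "(transition_shift c \<longlongrightarrow> 1) at_top"
    using tendsto_mult[OF tendsto_const[of "2 / pi"] filterlim_compose[OF tendsto_arctan_at_top top]]
    by (simp add: transition_shift_def[abs_def])
  show "(transition_shift c \<longlongrightarrow> - 1) at_bot"
    using tendsto_mult[OF tendsto_const[of "2 / pi"] filterlim_compose[OF tendsto_arctan_at_bot bot]]
    by (simp add: transition_shift_def[abs_def])
  have lim: "((\<lambda>x. 2 / pi * (c / (1 + x\<^sup>2))) \<longlongrightarrow> 2 / pi * 0) F"
    if "filterlim (\<lambda>x. x\<^sup>2) at_top F" for F :: "real filter"
    by (intro tendsto_intros real_tendsto_divide_at_top[OF tendsto_const]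
        filterlim_tendsto_add_at_top[OF tendsto_const] that)
  have "((\<lambda>x. 2 / pi * (c / (1 + x\<^sup>2))) \<longlongrightarrow> 0) at_top"
    using lim[OF filterlim_pow_at_top[OF _ filterlim_ident]] by simp
  from filterlim_compose[OF this top]
  show "((\<lambda>t. 2 / pi * (c / (1 + (c * t)\<^sup>2))) \<longlongrightarrow> 0) at_top" .
  have "((\<lambda>x. 2 / pi * (c / (1 + x\<^sup>2))) \<longlongrightarrow> 0) at_bot"
    using lim[OF filterlim_pow_at_bot_even[OF _ filterlim_ident]] by simp
  from filterlim_compose[OF this bot]
  show "((\<lambda>t. 2 / pi * (c / (1 + (c * t)\<^sup>2))) \<longlongrightarrow> 0) at_bot" .
qed

theorem theorem4p4:
  fixes p :: "real \<Rightarrow> real" and c :: real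
  assumes "bounded (range p)" and "uniformly_continuous_on UNIV p"
    and "card {b. hyperbolic (riccati p) b} = 2"
    and "c > 0"
    and "\<exists>b1 b2. b1 \<noteq> b2 \<and> hyperbolic (transition_eq p c) b1 \<and> hyperbolic (transition_eq p c) b2"
  shows
    "(R_minus p c = UNIV \<and> R_plus p c = UNIV \<and>
      {b. hyperbolic (transition_eq p c) b} = {lower_sol p c, upper_sol p c}) \<and>
     (\<forall>s y0. y0 > upper_sol p c s \<longrightarrow>
        \<not> bounded (left_part (transition_eq p c) s y0) \<and>
        {s..} \<subseteq> max_interval (transition_eq p c) s y0 \<and>
        ((\<lambda>t. \<bar>upper_sol p c t - max_solution (transition_eq p c) s y0 t\<bar>) \<longlongrightarrow> 0) at_top) \<and>
     (\<forall>s y0. lower_sol p c s < y0 \<and> y0 < upper_sol p c s \<longrightarrow>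
        max_interval (transition_eq p c) s y0 = UNIV \<and>
        bounded (range (max_solution (transition_eq p c) s y0)) \<and>
        ((\<lambda>t. \<bar>upper_sol p c t - max_solution (transition_eq p c) s y0 t\<bar>) \<longlongrightarrow> 0) at_top \<and>
        ((\<lambda>t. \<bar>lower_sol p c t - max_solution (transition_eq p c) s y0 t\<bar>) \<longlongrightarrow> 0) at_bot) \<and>
     (\<forall>s y0. y0 < lower_sol p c s \<longrightarrow>
        \<not> bounded (right_part (transition_eq p c) s y0) \<and>
        {..s} \<subseteq> max_interval (transition_eq p c) s y0 \<and>
        ((\<lambda>t. \<bar>lower_sol p c t - max_solution (transition_eq p c) s y0 t\<bar>) \<longlongrightarrow> 0) at_bot) \<and>
     (((\<lambda>t. \<bar>a_plus p t - upper_sol p c t\<bar>) \<longlongrightarrow> 0) at_top \<and>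
      ((\<lambda>t. \<bar>a_minus p t - upper_sol p c t\<bar>) \<longlongrightarrow> 0) at_bot \<and>
      ((\<lambda>t. \<bar>r_plus p t - lower_sol p c t\<bar>) \<longlongrightarrow> 0) at_top \<and>
      ((\<lambda>t. \<bar>r_minus p t - lower_sol p c t\<bar>) \<longlongrightarrow> 0) at_bot)"
proof -
  define g where "g = transition_shift c"
  note h = transition_eq_shifted[of p c, folded g_def]
  note bp = assms(1)
  have bg: "bounded (range g)" unfolding g_def by (rule bounded_transition_shift)
  note g_deriv = transition_shift_deriv[of c, folded g_def]
  note g_lim = transition_shift_limits[OF \<open>c > 0\<close>, folded g_def]
  have g_cont: "continuous_on UNIV g"
    using g_deriv by (meson DERIV_isCont continuous_at_imp_continuous_on)
  have b0: "bounded (range (\<lambda>_. 0::real))" by auto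
  from assms(5) obtain b where "hyperbolic (shifted_riccati g p) b" unfolding h by blast
  then obtain a r where a: "attractive_hyperbolic (shifted_riccati g p) a"
    and r: "repulsive_hyperbolic (shifted_riccati g p) r" and "\<And>s. r s < a s"
    using attractive_repulsive_pair[OF g_cont bg bp] by blast
  \<comment> \<open>These two equivalences turn the extremal descriptions of \<open>\<aa>\<^sub>c\<close> and \<open>\<rr>\<^sub>c\<close> into \<open>a\<close> and \<open>r\<close>.\<close>
  note left = attractive_portrait(1)[OF g_cont bg bp a]
  note right = repulsive_portrait(1)[OF g_cont bg bp r]
  have upper: "upper_sol p c = a"
    unfolding upper_sol_def h left by (rule ext, rule Greatest_equality) auto
  have lower: "lower_sol p c = r"
    unfolding lower_sol_def h right by (rule ext, rule Least_equality) auto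
  have hyp: "{b. hyperbolic (shifted_riccati g p) b} = {r, a}"
    unfolding hyperbolic_def
    using attractive_unique[OF g_cont bg bp a] repulsive_unique[OF g_cont bg bp r] a r by blast
  \<comment> \<open>The portrait of \<open>a\<close> supplies a repulsive solution of its own; uniqueness identifies it
    with \<open>r\<close>, and likewise \<open>a'\<close> with \<open>a\<close> below.\<close>
  obtain r' where r': "repulsive_hyperbolic (shifted_riccati g p) r'"
    and fwd': "\<And>s y0. r' s < y0 \<Longrightarrow> {s..} \<subseteq> max_interval (shifted_riccati g p) s y0"
      "\<And>s y0. r' s < y0 \<Longrightarrow>
        ((\<lambda>t. \<bar>a t - max_solution (shifted_riccati g p) s y0 t\<bar>) \<longlongrightarrow> 0) at_top"
    using attractive_portrait(2)[OF g_cont bg bp a] by blast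
  have "r' = r" using repulsive_unique[OF g_cont bg bp r' r] .
  note fwd = fwd'[unfolded this]
  obtain a' where a': "attractive_hyperbolic (shifted_riccati g p) a'"
    and bwd': "\<And>s y0. y0 < a' s \<Longrightarrow> {..s} \<subseteq> max_interval (shifted_riccati g p) s y0"
      "\<And>s y0. y0 < a' s \<Longrightarrow>
        ((\<lambda>t. \<bar>r t - max_solution (shifted_riccati g p) s y0 t\<bar>) \<longlongrightarrow> 0) at_bot"
    using repulsive_portrait(2)[OF g_cont bg bp r] by blast
  have "a' = a" using attractive_unique[OF g_cont bg bp a' a] .
  note bwd = bwd'[unfolded this]
  have a_sol: "solution_on (shifted_riccati g p) UNIV a" using a by (simp add: attractive_hyperbolic_def)
  have r_sol: "solution_on (shifted_riccati g p) UNIV r" using r by (simp add: repulsive_hyperbolic_def)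

  have A1: "R_minus p c = UNIV" "R_plus p c = UNIV"
    unfolding R_minus_def R_plus_def h left right by auto

  have A3: "max_interval (shifted_riccati g p) s y0 = UNIV"
    "bounded (range (max_solution (shifted_riccati g p) s y0))" if y0: "r s < y0" "y0 < a s" for s y0
  proof -
    have "{s..} \<union> {..s} \<subseteq> max_interval (shifted_riccati g p) s y0"
      using fwd(1)[OF y0(1)] bwd(1)[OF y0(2)] by simp
    moreover have "{s..} \<union> {..s} = UNIV" by auto
    ultimately show univ: "max_interval (shifted_riccati g p) s y0 = UNIV" by (simp only: top_unique)
    obtain A where A: "\<And>t. \<bar>a t\<bar> \<le> A"
      using bounded_of_global_solution[OF bg bp a_sol] by (auto simp: bounded_iff)
    obtain R where R: "\<And>t. \<bar>r t\<bar> \<le> R"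
      using bounded_of_global_solution[OF bg bp r_sol] by (auto simp: bounded_iff)
    have "\<bar>max_solution (shifted_riccati g p) s y0 t\<bar> \<le> A + R" for t
    proof -
      have "t \<in> max_interval (shifted_riccati g p) s y0" using univ by simp
      then obtain I x where x: "solution_on (shifted_riccati g p) I x" "s \<in> I" "t \<in> I" "x s = y0"
        by (rule max_intervalE)
      have I: "solution_on (shifted_riccati g p) I a" "solution_on (shifted_riccati g p) I r"
        using a_sol r_sol x(1) by (auto simp: solution_on_def)
      obtain k1 where "k1 > 0" "a t - x t = k1 * (a s - x s)"
        using solution_difference_scaling[OF g_cont I(1) x(1-3)] .
      then have "a t - x t > 0" using y0 x(4) by simp
      moreover obtain k2 where "k2 > 0" "x t - r t = k2 * (x s - r s)"
        using solution_difference_scaling[OF g_cont x(1) I(2) x(2,3)] .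
      then have "x t - r t > 0" using y0 x(4) by simp
      moreover have "max_solution (shifted_riccati g p) s y0 t = x t"
        using max_solution_eq[OF g_cont x(1-3)] x(4) by simp
      ultimately show ?thesis using A[of t] R[of t] by linarith
    qed
    then show "bounded (range (max_solution (shifted_riccati g p) s y0))"
      by (auto simp: bounded_iff)
  qed

  have "{b. hyperbolic (riccati p) b} \<noteq> {}" using assms(3) by (auto simp del: Collect_empty_eq)
  then obtain b0 where "hyperbolic (shifted_riccati (\<lambda>_. 0) p) b0" unfolding riccati_shifted by blast
  then obtain a0 r0 where a0: "attractive_hyperbolic (shifted_riccati (\<lambda>_. 0) p) a0"
    and r0: "repulsive_hyperbolic (shifted_riccati (\<lambda>_. 0) p) r0"
    using attractive_repulsive_pair[OF continuous_on_const b0 bp] by blast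
  have a_tilde: "a_tilde p = a0"
    unfolding a_tilde_def riccati_shifted
    using a0 attractive_unique[OF continuous_on_const b0 bp] by blast
  have r_tilde: "r_tilde p = r0"
    unfolding r_tilde_def riccati_shifted
    using r0 repulsive_unique[OF continuous_on_const b0 bp] by blast
  have shift: "((\<lambda>t. \<bar>z t + l - x t\<bar>) \<longlongrightarrow> 0) F"
    if "((\<lambda>t. x t - g t - z t) \<longlongrightarrow> 0) F" "(g \<longlongrightarrow> l) F" for x z l F
  proof -
    have "((\<lambda>t. \<bar>(l - g t) - (x t - g t - z t)\<bar>) \<longlongrightarrow> \<bar>(l - l) - 0\<bar>) F"
      by (intro tendsto_intros that)
    then show ?thesis by (simp add: algebra_simps)
  qed
  note attr = attractive_shift_asymptotics[OF g_deriv bg bp a a0]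
  note rep = repulsive_shift_asymptotics[OF g_deriv bg bp r r0]
  have A5: "((\<lambda>t. \<bar>a_plus p t - a t\<bar>) \<longlongrightarrow> 0) at_top" "((\<lambda>t. \<bar>a_minus p t - a t\<bar>) \<longlongrightarrow> 0) at_bot"
    "((\<lambda>t. \<bar>r_plus p t - r t\<bar>) \<longlongrightarrow> 0) at_top" "((\<lambda>t. \<bar>r_minus p t - r t\<bar>) \<longlongrightarrow> 0) at_bot"
    using shift[OF attr(1)[OF g_lim(3)] g_lim(1)] shift[OF attr(2)[OF g_lim(4)] g_lim(2)]
      shift[OF rep(1)[OF g_lim(3)] g_lim(1)] shift[OF rep(2)[OF g_lim(4)] g_lim(2)]
    by (simp_all add: a_plus_def a_minus_def r_plus_def r_minus_def a_tilde r_tilde)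

  show ?thesis
    unfolding upper lower h
  proof (intro conjI allI impI; (elim conjE)?)
    fix s y0 assume y0: "y0 > a s"
    then show "\<not> bounded (left_part (shifted_riccati g p) s y0)"
      using left[of s y0] bounded_imp_bdd_above by fastforce
    have "r s < y0" using y0 \<open>r s < a s\<close> by simp
    then show "{s..} \<subseteq> max_interval (shifted_riccati g p) s y0"
      "((\<lambda>t. \<bar>a t - max_solution (shifted_riccati g p) s y0 t\<bar>) \<longlongrightarrow> 0) at_top"
      by (rule fwd)+
  next
    fix s y0 assume y0: "y0 < r s"
    then show "\<not> bounded (right_part (shifted_riccati g p) s y0)"
      using right[of s y0] bounded_imp_bdd_below by fastforce
    have "y0 < a s" using y0 \<open>r s < a s\<close> by simp
    then show "{..s} \<subseteq> max_interval (shifted_riccati g p) s y0"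
      "((\<lambda>t. \<bar>r t - max_solution (shifted_riccati g p) s y0 t\<bar>) \<longlongrightarrow> 0) at_bot"
      by (rule bwd)+
  qed (fact A1 hyp A5 | rule A3 fwd bwd, assumption+)+
qed

end
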